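(* Each of the three types of minimal sets in the classification is realized: there exist $f_1,f_2,f_3\in\mathrm{Homeo}_*(\mathbb{T}^2)$ with minimal sets $\mathcal{M}_1,\mathcal{M}_2,\mathcal{M}_3\ne\mathbb{T}^2$ such that (I) every connected component of $\mathbb{T}^2\setminus\mathcal{M}_1$ is a disk; (II) every connected component of $\mathbb{T}^2\setminus\mathcal{M}_2$ is a disk or an essential annulus, and essential annuli occur; (III) $\mathcal{M}_3$ is an extension of a Cantor set.
   Context: $\mathbb{T}^2=\mathbb{R}^2/\mathbb{Z}^2$ with projection $p$. $\mathrm{Homeo}_*(\mathbb{T}^2)$ is the set of homeomorphisms of $\mathbb{T}^2$ isotopic to the identity whose rotation set (the set of limit points mod $\mathbb{Z}^2$ of $(F^{n_k}(\tilde z)-\tilde z)/n_k$, $n_k\to\infty$, $\tilde z\in\mathbb{R}^2$, for a lift $F$) is a single point $(\alpha,\beta)\bmod\mathbb{Z}^2$ with $1,\alpha,\beta$ rationally independent. A minimal set is a nonempty closed invariant set with no proper nonempty closed invariant subset. A disk is the image of the open unit disk under a topological embedding into $\mathbb{T}^2$; an essential annulus is an embedded image of $S^1\times(0,1)$ whose inclusion induces an injection on $\pi_1$. A set is bounded if a connected component of its preimage under $p$ is bounded. For a bounded continuum $\mathcal{C}$, $\mathrm{Fill}(\mathcal{C})$ is the smallest bounded continuum with connected complement containing it (such continua are called acyclic). A minimal set $\mathcal{M}$ with components $\{\Lambda_i\}$ is an extension of a Cantor set if each $\mathrm{Fill}(\Lambda_i)$ is acyclic, these fills are pairwise disjoint,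 and there exist a continuous $\phi:\mathbb{T}^2\to\mathbb{T}^2$ homotopic to the identity and $\hat f\in\mathrm{Homeo}_*(\mathbb{T}^2)$ with $\phi\circ f=\hat f\circ\phi$ such that $\phi(\bigcup_i\mathrm{Fill}(\Lambda_i))$ is a Cantor minimal set of $\hat f$. *)

theory Defs
  imports "HOL-Analysis.Analysis"
begin

text \<open>The torus T2 = R^2/Z^2, realised concretely as the product of two unit circles in
  complex x complex, with covering projection p(x,y) = (cis(2 pi x), cis(2 pi y)).\<close>

definition T2 :: "(complex \<times> complex) set" where
  "T2 = sphere 0 1 \<times> sphere 0 1"

definition proj :: "real \<times> real \<Rightarrow> complex \<times> complex" where
  "proj z = (cis (2 * pi * fst z), cis (2 * pi * snd z))"

definition is_lift :: "(complex \<times> complex \<Rightarrow> complex \<times> complex) \<Rightarrow> (real \<times> real \<Rightarrow> real \<times> real) \<Rightarrow> bool" where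
  "is_lift f F \<longleftrightarrow> continuous_on UNIV F \<and> (\<forall>z. proj (F z) = f (proj z))"

text \<open>Rotation set (Misiurewicz--Ziemian): limit points of (F^n_k(z_k) - z_k)/n_k, n_k \<rightarrow> \<infinity>.\<close>
definition rotation_set :: "(real \<times> real \<Rightarrow> real \<times> real) \<Rightarrow> (real \<times> real) set" where
  "rotation_set F = {v. \<exists>(n::nat \<Rightarrow> nat) (z::nat \<Rightarrow> real \<times> real).
       filterlim n at_top sequentially \<and>
       ((\<lambda>k. inverse (real (n k)) *\<^sub>R ((F ^^ n k) (z k) - z k)) \<longlonglongrightarrow> v)}"

definition rat_indep :: "real \<Rightarrow> real \<Rightarrow> bool" where
  "rat_indep a b \<longleftrightarrow> (\<forall>i j k :: int. of_int i + of_int j * a + of_int k * b = 0 \<longrightarrow> i = 0 \<and> j = 0 \<and> k = 0)"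

definition is_homeo_T2 :: "(complex \<times> complex \<Rightarrow> complex \<times> complex) \<Rightarrow> bool" where
  "is_homeo_T2 f \<longleftrightarrow> (\<exists>g. homeomorphism T2 T2 f g)"

definition isotopic_to_id :: "(complex \<times> complex \<Rightarrow> complex \<times> complex) \<Rightarrow> bool" where
  "isotopic_to_id f \<longleftrightarrow> homotopic_with_canon is_homeo_T2 T2 T2 f id"

definition homeo_star :: "(complex \<times> complex \<Rightarrow> complex \<times> complex) \<Rightarrow> bool" where
  "homeo_star f \<longleftrightarrow> is_homeo_T2 f \<and> isotopic_to_id f \<and>
     (\<exists>F a b. is_lift f F \<and> rotation_set F = {(a, b)} \<and> rat_indep a b)"

definition minimal_set :: "(complex \<times> complex \<Rightarrow> complex \<times> complex) \<Rightarrow> (complex \<times> complex) set \<Rightarrow> bool" where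
  "minimal_set f M \<longleftrightarrow> M \<subseteq> T2 \<and> M \<noteq> {} \<and> closed M \<and> f ` M = M \<and>
     (\<forall>N. N \<subseteq> M \<and> N \<noteq> {} \<and> closed N \<and> f ` N = N \<longrightarrow> N = M)"

definition is_disk :: "(complex \<times> complex) set \<Rightarrow> bool" where
  "is_disk U \<longleftrightarrow> U \<subseteq> T2 \<and> (ball (0::complex) 1) homeomorphic U"

definition pi1_injective :: "'a::real_normed_vector set \<Rightarrow> 'a set \<Rightarrow> bool" where
  "pi1_injective A X \<longleftrightarrow> (\<forall>\<gamma>. path \<gamma> \<and> path_image \<gamma> \<subseteq> A \<and> pathfinish \<gamma> = pathstart \<gamma> \<and>
      homotopic_paths X \<gamma> (linepath (pathstart \<gamma>) (pathstart \<gamma>)) \<longrightarrow>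
      homotopic_paths A \<gamma> (linepath (pathstart \<gamma>) (pathstart \<gamma>)))"

definition is_essential_annulus :: "(complex \<times> complex) set \<Rightarrow> bool" where
  "is_essential_annulus U \<longleftrightarrow> U \<subseteq> T2 \<and>
     (sphere (0::complex) 1 \<times> {0<..<(1::real)}) homeomorphic U \<and> pi1_injective U T2"

definition bounded_T2 :: "(complex \<times> complex) set \<Rightarrow> bool" where
  "bounded_T2 K \<longleftrightarrow> (\<exists>C \<in> components (proj -` K). bounded C)"

definition continuum_T2 :: "(complex \<times> complex) set \<Rightarrow> bool" where
  "continuum_T2 K \<longleftrightarrow> K \<subseteq> T2 \<and> K \<noteq> {} \<and> compact K \<and> connected K"

definition acyclic_T2 :: "(complex \<times> complex) set \<Rightarrow> bool" where
  "acyclic_T2 K \<longleftrightarrow> continuum_T2 K \<and> bounded_T2 K \<and> connected (T2 - K)"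

definition is_fill :: "(complex \<times> complex) set \<Rightarrow> (complex \<times> complex) set \<Rightarrow> bool" where
  "is_fill C K \<longleftrightarrow> acyclic_T2 K \<and> C \<subseteq> K \<and> (\<forall>K'. acyclic_T2 K' \<and> C \<subseteq> K' \<longrightarrow> K \<subseteq> K')"

definition cantor_set :: "'a::topological_space set \<Rightarrow> bool" where
  "cantor_set S \<longleftrightarrow> S \<noteq> {} \<and> compact S \<and> (\<forall>x\<in>S. x islimpt S) \<and>
     (\<forall>x\<in>S. connected_component_set S x = {x})"

definition extension_of_cantor :: "(complex \<times> complex \<Rightarrow> complex \<times> complex) \<Rightarrow> (complex \<times> complex) set \<Rightarrow> bool" where
  "extension_of_cantor f M \<longleftrightarrow>
     (\<exists>Fl. (\<forall>L \<in> components M. is_fill L (Fl L)) \<and>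
        (\<forall>L1 \<in> components M. \<forall>L2 \<in> components M. L1 \<noteq> L2 \<longrightarrow> Fl L1 \<inter> Fl L2 = {}) \<and>
        (\<exists>\<phi> fh. continuous_on T2 \<phi> \<and> \<phi> ` T2 \<subseteq> T2 \<and>
           homotopic_with_canon (\<lambda>_. True) T2 T2 \<phi> id \<and> homeo_star fh \<and>
           (\<forall>x \<in> T2. \<phi> (f x) = fh (\<phi> x)) \<and>
           minimal_set fh (\<phi> ` \<Union>(Fl ` components M)) \<and>
           cantor_set (\<phi> ` \<Union>(Fl ` components M))))"

end

theory Submission
  imports Defs
begin

text \<open>All three minimal sets come from one Denjoy-type construction over the rotation by
  \<open>(\<alpha>, \<beta>)\<close>. In the fibre over \<open>x\<close>, the points \<open>n\<beta>\<close> are blown up to intervals of length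
  \<open>w\<^sub>n \<tau>(x - n\<alpha>)\<close> with \<open>\<Sum>w\<^sub>n \<le> 1/2\<close>; the cut-off \<open>\<tau>\<close> does not interfere with the dynamics,
  because the rotation moves \<open>n\<beta>\<close> over \<open>x\<close> to \<open>(n + 1)\<beta>\<close> over \<open>x + \<alpha>\<close>, where the argument of
  \<open>\<tau>\<close> is the same. The resulting homeomorphism is semiconjugate to the rotation, and the closure
  of the points with a singleton fibre is its minimal set.

  If \<open>\<tau>\<close> is a bump supported on \<open>[-1/4, 1/4]\<close>, then the blown-up regions are disjoint
  lens-shaped disks (type I). If \<open>\<tau> = 1\<close>, they are annuli, and the map is the product of a
  rotation with a Denjoy homeomorphism (type II). The product of two Denjoy homeomorphisms has
  as its minimal set a product of two Cantor sets, which extends itself trivially (type III).\<close>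

subsection \<open>Weighted sums over the integers\<close>

text \<open>The constants in \<open>wt\<close> serve two purposes. Total weight at most 1/2 leaves
  \<open>Gp x\<close> with slope at least 1/2 after the weighted sum is subtracted, so its monotone
  inverse \<open>\<phi> x\<close> is single-valued and Lipschitz; this yields a continuous
  semiconjugacy. Each weight at most 1/4 keeps a blown-up interval shorter than one period, so that
  it embeds in the circle. The delicate point is continuity of the lifted homeomorphism where \<tau>
  vanishes: the inserted intervals collapse there, and a coordinate relative to their length has no
  limit. Positions are therefore measured by a number between 0 and \<open>T n x\<close>, obtained
  by dividing by \<open>wt n\<close> alone and never by a value of \<tau>. The rotation set needs no
  analysis of orbits either: the semiconjugacy stays within bounded distance of the identity, so the
  displacement of \<open>n\<close> iterates differs from that of the translation by a bounded
  amount.\<close>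

definition wt :: "int \<Rightarrow> real" where
  "wt n = (1/2) ^ to_nat n / 4"

definition wsum :: "(int \<Rightarrow> real) \<Rightarrow> real" where
  "wsum g = (\<Sum>\<^sub>\<infinity>n. wt n * g n)"

lemma wt_pos: "wt n > 0"
  by (simp add: wt_def)

lemma summable_on_wt: "wt summable_on UNIV"
  and infsum_wt_le: "infsum wt UNIV \<le> 1/2"
proof -
  define g :: "nat \<Rightarrow> real" where "g k = (1/2) ^ k / 4" for k
  have "g sums (2 * (1/4))"
    unfolding g_def using geometric_sums[of "1/2::real"] sums_mult2[of "\<lambda>k. (1/2::real)^k" 2 "1/4"] by simp
  then have hs: "(g has_sum (1/2)) UNIV"
    by (intro sums_nonneg_imp_has_sum) (auto simp: g_def)
  have gs: "g summable_on range (to_nat :: int \<Rightarrow> nat)"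
    by (rule summable_on_subset[OF has_sum_imp_summable[OF hs]]) auto
  have wg: "wt = g \<circ> to_nat" by (auto simp: wt_def g_def)
  show "wt summable_on UNIV"
    unfolding wg using gs by (subst summable_on_reindex[symmetric]) auto
  have "infsum wt UNIV = infsum g (range (to_nat :: int \<Rightarrow> nat))"
    unfolding wg by (subst infsum_reindex) auto
  also have "\<dots> \<le> infsum g UNIV"
    by (rule infsum_mono_neutral) (use gs has_sum_imp_summable[OF hs] in \<open>auto simp: g_def\<close>)
  also have "\<dots> = 1/2" using hs by (simp add: infsumI)
  finally show "infsum wt UNIV \<le> 1/2" .
qed

lemma wsum_summable:
  assumes "\<And>n. \<bar>g n\<bar> \<le> B"
  shows "(\<lambda>n. wt n * g n) summable_on UNIV"
proof -
  have "(\<lambda>n. wt n * B) summable_on UNIV"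
    by (rule summable_on_cmult_left[OF summable_on_wt])
  then show ?thesis
  proof (rule Infinite_Sum.abs_summable_on_comparison_test'[THEN abs_summable_summable])
    show "norm (wt n * g n) \<le> wt n * B" for n
      using assms[of n] wt_pos[of n] by (simp add: abs_mult)
  qed
qed

lemma wsum_add:
  assumes "\<And>n. \<bar>g n\<bar> \<le> B" "\<And>n. \<bar>h n\<bar> \<le> C"
  shows "wsum (\<lambda>n. g n + h n) = wsum g + wsum h"
  unfolding wsum_def distrib_left
  by (rule infsum_add) (rule wsum_summable assms)+

lemma wsum_cmult: "wsum (\<lambda>n. c * g n) = c * wsum g"
proof -
  have "wsum (\<lambda>n. c * g n) = (\<Sum>\<^sub>\<infinity>n. c * (wt n * g n))"
    by (simp add: wsum_def mult_ac)
  then show ?thesis by (simp add: wsum_def infsum_cmult_right')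
qed

lemma wsum_diff:
  assumes "\<And>n. \<bar>g n\<bar> \<le> B" "\<And>n. \<bar>h n\<bar> \<le> C"
  shows "wsum (\<lambda>n. g n - h n) = wsum g - wsum h"
  using wsum_add[of g B "\<lambda>n. (-1) * h n" C] wsum_cmult[of "-1" h] assms by simp

lemma wsum_mono:
  assumes "\<And>n. \<bar>g n\<bar> \<le> B" "\<And>n. \<bar>h n\<bar> \<le> C" "\<And>n. g n \<le> h n"
  shows "wsum g \<le> wsum h"
  unfolding wsum_def
  by (rule infsum_mono) (use wsum_summable assms wt_pos less_imp_le in \<open>auto intro!: mult_left_mono\<close>)

lemma wsum_single: "wsum (\<lambda>k. if k = n then c else 0) = wt n * c"
proof -
  have "wsum (\<lambda>k. if k = n then c else 0) = (\<Sum>\<^sub>\<infinity>k\<in>{n}. wt k * c)"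
    unfolding wsum_def by (rule infsum_cong_neutral) auto
  then show ?thesis by simp
qed

lemma wsum_const_le: "c \<ge> 0 \<Longrightarrow> wsum (\<lambda>n. c) \<le> c / 2"
  using mult_right_mono[OF infsum_wt_le, of c] by (simp add: wsum_def infsum_cmult_left')

lemma wsum_bounds:
  assumes "\<And>n. 0 \<le> g n" "\<And>n. g n \<le> B"
  shows "0 \<le> wsum g" "wsum g \<le> B / 2"
proof -
  have ab: "\<bar>g n\<bar> \<le> B" for n using assms[of n] by simp
  have "B \<ge> 0" using assms[of 0] by linarith
  have "wsum (\<lambda>n. 0) \<le> wsum g" by (rule wsum_mono[where B = 0, OF _ ab]) (use assms in auto)
  then show "0 \<le> wsum g" by (simp add: wsum_def)
  have "wsum g \<le> wsum (\<lambda>n. B)" by (rule wsum_mono[OF ab, where C = B]) (use assms \<open>B \<ge> 0\<close> in auto)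
  then show "wsum g \<le> B / 2" using wsum_const_le[OF \<open>B \<ge> 0\<close>] by linarith
qed

lemma wsum_abs_diff_le:
  assumes "\<And>n. \<bar>g n\<bar> \<le> B" "\<And>n. \<bar>h n\<bar> \<le> C" "\<And>n. \<bar>g n - h n\<bar> \<le> D"
  shows "\<bar>wsum g - wsum h\<bar> \<le> D / 2"
proof -
  have D: "D \<ge> 0" using assms(3)[of 0] by linarith
  have c: "wsum (\<lambda>n. D) \<le> D / 2" by (rule wsum_const_le[OF D])
  have "wsum g \<le> wsum (\<lambda>n. h n + D)"
  proof (rule wsum_mono[where C="C+D", OF assms(1)])
    show "\<bar>h n + D\<bar> \<le> C + D" for n using assms(2)[of n] D by linarith
    show "g n \<le> h n + D" for n using assms(3)[of n] by linarith
  qed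
  also have "\<dots> = wsum h + wsum (\<lambda>n. D)"
    by (rule wsum_add[where B = C and C = D]) (use assms D in auto)
  finally have 1: "wsum g - wsum h \<le> D / 2" using c by linarith
  have "wsum h \<le> wsum (\<lambda>n. g n + D)"
  proof (rule wsum_mono[where C="B+D", OF assms(2)])
    show "\<bar>g n + D\<bar> \<le> B + D" for n using assms(1)[of n] D by linarith
    show "h n \<le> g n + D" for n using assms(3)[of n] by linarith
  qed
  also have "\<dots> = wsum g + wsum (\<lambda>n. D)"
    by (rule wsum_add[where B = B and C = D]) (use assms D in auto)
  finally have 2: "wsum h - wsum g \<le> D / 2" using c by linarith
  show ?thesis using 1 2 by linarith
qed

text \<open>Every weight is positive, so one strict inequality survives summation: the excess at
  \<open>m\<close> is added to \<open>g\<close> as a spike \<open>d\<close>, whose sum is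
  \<open>wt m * (h m - g m)\<close>.\<close>

lemma wsum_strict_mono:
  assumes "\<And>n. \<bar>g n\<bar> \<le> B" "\<And>n. \<bar>h n\<bar> \<le> C" "\<And>n. g n \<le> h n" "g m < h m"
  shows "wsum g < wsum h"
proof -
  define d where "d = (\<lambda>k. if k = m then h m - g m else 0)"
  have db: "\<bar>d k\<bar> \<le> B + C" for k using assms(1,2)[of m] assms(1,2)[of k] by (auto simp: d_def)
  have "wsum (\<lambda>n. g n + d n) \<le> wsum h"
  proof (rule wsum_mono[OF _ assms(2)])
    show "\<bar>g n + d n\<bar> \<le> B + (B + C)" for n using assms(1)[of n] db[of n] by linarith
    show "g n + d n \<le> h n" for n using assms(3)[of n] by (auto simp: d_def)
  qed
  also have "wsum (\<lambda>n. g n + d n) = wsum g + wt m * (h m - g m)"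
    by (subst wsum_add[OF assms(1) db]) (simp add: wsum_single d_def)
  finally show ?thesis using mult_pos_pos[OF wt_pos[of m], of "h m - g m"] assms(4) by linarith
qed

text \<open>Dominated convergence: the bound \<open>B\<close> makes the finite partial sums converge
  uniformly in \<open>i\<close>, so the limits may be exchanged. The filter is arbitrary because
  one-sided limits as well as continuity on a set are needed.\<close>

lemma wsum_tendsto:
  assumes "\<And>i n. \<bar>g i n\<bar> \<le> B" "\<And>n. ((\<lambda>i. g i n) \<longlongrightarrow> l n) F"
  shows "((\<lambda>i. wsum (g i)) \<longlongrightarrow> wsum l) F"
proof (cases "F = bot")
  case False
  have lb: "\<bar>l n\<bar> \<le> B" for n
    by (rule tendsto_upperbound[OF tendsto_rabs[OF assms(2)]]) (use assms(1) False in auto)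
  have ul: "uniform_limit UNIV (\<lambda>X i. \<Sum>n\<in>X. wt n * g i n) (\<lambda>i. \<Sum>\<^sub>\<infinity>n\<in>UNIV. wt n * g i n)
      (finite_subsets_at_top UNIV)"
  proof (rule Weierstrass_m_test_general)
    show "norm (wt n * g i n) \<le> wt n * B" for n i
      using assms(1)[of i n] wt_pos[of n] by (simp add: abs_mult)
    show "(\<lambda>n. wt n * B) summable_on UNIV"
      by (rule summable_on_cmult_left[OF summable_on_wt])
  qed
  show ?thesis
    unfolding wsum_def
  proof (rule swap_uniform_limit'[OF _ _ ul])
    show "\<forall>\<^sub>F X in finite_subsets_at_top UNIV. ((\<lambda>i. \<Sum>n\<in>X. wt n * g i n) \<longlongrightarrow> (\<Sum>n\<in>X. wt n * l n)) F"
      by (intro always_eventually allI tendsto_sum tendsto_mult tendsto_const assms(2))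
    show "((\<lambda>X. \<Sum>n\<in>X. wt n * l n) \<longlongrightarrow> (\<Sum>\<^sub>\<infinity>n. wt n * l n)) (finite_subsets_at_top UNIV)"
      using has_sum_infsum[OF wsum_summable[OF lb]] by (simp add: has_sum_def)
  qed auto
qed auto

lemma continuous_on_wsum:
  assumes "\<And>i n. \<bar>g i n\<bar> \<le> B" "\<And>n. continuous_on S (\<lambda>i. g i n)"
  shows "continuous_on S (\<lambda>i. wsum (g i))"
  unfolding continuous_on_def
proof
  fix x assume "x \<in> S"
  then show "((\<lambda>i. wsum (g i)) \<longlongrightarrow> wsum (g x)) (at x within S)"
    using assms(2) by (intro wsum_tendsto[where g = g and l = "g x", OF assms(1)]) (auto simp: continuous_on_def)
qed

section \<open>One-sided limits of the fractional part\<close>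

lemma frac_at_right: "(frac \<longlongrightarrow> frac u) (at_right (u::real))"
proof -
  have "\<forall>\<^sub>F v in at_right u. v \<in> {u<..<of_int \<lfloor>u\<rfloor> + 1}"
    by (rule eventually_at_right_real) linarith
  then have "\<forall>\<^sub>F v in at_right u. v - of_int \<lfloor>u\<rfloor> = frac v"
  proof eventually_elim
    case (elim v)
    then have "\<lfloor>v\<rfloor> = \<lfloor>u\<rfloor>" by (simp add: floor_eq_iff) linarith
    then show ?case by (simp add: frac_def)
  qed
  moreover have "((\<lambda>v. v - of_int \<lfloor>u\<rfloor>) \<longlongrightarrow> u - of_int \<lfloor>u\<rfloor>) (at_right u)"
    by (intro tendsto_intros)
  ultimately show ?thesis unfolding frac_def[of u] by (rule Lim_transform_eventually[rotated])
qed

text \<open>The expression \<open>1 - frac (-u)\<close> agrees with \<open>frac u\<close> off the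
  integers and equals 1 on them, so one formula covers both kinds of points; the summands of
  \<open>Gm\<close> come from it.\<close>

lemma frac_at_left: "(frac \<longlongrightarrow> 1 - frac (-u)) (at_left (u::real))"
proof -
  have "\<forall>\<^sub>F v in at_left u. v \<in> {of_int \<lceil>u\<rceil> - 1<..<u}"
    by (rule eventually_at_left_real) linarith
  then have ev: "\<forall>\<^sub>F v in at_left u. v - (of_int \<lceil>u\<rceil> - 1) = frac v"
  proof eventually_elim
    case (elim v)
    then have "\<lfloor>v\<rfloor> = \<lceil>u\<rceil> - 1" by (simp add: floor_eq_iff) linarith
    then show ?case by (simp add: frac_def)
  qed
  have lim: "((\<lambda>v. v - (of_int \<lceil>u\<rceil> - 1)) \<longlongrightarrow> u - (of_int \<lceil>u\<rceil> - 1)) (at_left u)"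
    by (intro tendsto_intros)
  have eq: "u - (of_int \<lceil>u\<rceil> - 1) = 1 - frac (-u)"
    by (simp add: frac_def ceiling_def)
  show ?thesis using Lim_transform_eventually[OF lim ev] unfolding eq .
qed

lemma frac_jump: "1 - frac (-u) - frac (u::real) = (if u \<in> \<int> then 1 else 0)"
  by (simp add: frac_neg)

text \<open>Apart from downward jumps \<open>frac\<close> has slope 1, so it rises by at most
  \<open>u' - u\<close>; the left limit ignores a jump at \<open>u'\<close> itself.\<close>

lemma left_limit_le_frac_add: "u < (u'::real) \<Longrightarrow> 1 - frac (-u') \<le> frac u + (u' - u)"
proof -
  assume "u < u'"
  moreover have "- u' < of_int \<lfloor>- u'\<rfloor> + 1" "of_int \<lfloor>u\<rfloor> \<le> u" by linarith+
  ultimately have "of_int (\<lfloor>u\<rfloor> + \<lfloor>- u'\<rfloor>) < (0::real)" by linarith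
  then have "\<lfloor>u\<rfloor> + \<lfloor>- u'\<rfloor> \<le> - 1" by linarith
  then have "of_int \<lfloor>u\<rfloor> + of_int \<lfloor>- u'\<rfloor> \<le> (- 1 :: real)" by (simp flip: of_int_add)
  then show ?thesis by (simp add: frac_def)
qed

subsection \<open>The fibrewise blow-up\<close>

text \<open>Irrationality of \<beta> (\<open>irr\<close>) keeps the points n\<beta> distinct modulo
  1. The Lipschitz condition on \<tau> gives all \<open>T n\<close> one common modulus of
  continuity, which passes to the weighted sums.\<close>

locale blowup =
  fixes \<alpha> \<beta> :: real and \<tau> :: "real \<Rightarrow> real" and L :: real
  assumes irr: "\<And>n m :: int. of_int n * \<beta> = of_int m \<Longrightarrow> n = 0"
    and tau_range: "0 \<le> \<tau> x" "\<tau> x \<le> 1"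
    and tau_periodic: "\<tau> (x + 1) = \<tau> x"
    and tau_lipschitz: "\<bar>\<tau> x - \<tau> x'\<bar> \<le> L * \<bar>x - x'\<bar>"
begin

text \<open>The fibrewise jump function has a jump of height \<open>wt n * \<tau> (x - n\<alpha>)\<close> at every
  point of \<open>n\<beta> + \<int>\<close>. It is right-continuous with value \<open>Gp\<close> and left limit \<open>Gm\<close>, and
  its monotone inverse is \<open>\<phi>\<close>.\<close>

definition T :: "int \<Rightarrow> real \<Rightarrow> real" where
  "T n x = \<tau> (x - of_int n * \<alpha>)"

definition Gp :: "real \<Rightarrow> real \<Rightarrow> real" where
  "Gp x y = y - wsum (\<lambda>n. T n x * frac (y - of_int n * \<beta>))"

definition Gm :: "real \<Rightarrow> real \<Rightarrow> real" where
  "Gm x y = y - wsum (\<lambda>n. T n x * (1 - frac (of_int n * \<beta> - y)))"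

definition \<phi> :: "real \<Rightarrow> real \<Rightarrow> real" where
  "\<phi> x t = (THE y. Gm x y \<le> t \<and> t \<le> Gp x y)"

lemma T_range: "0 \<le> T n x" "T n x \<le> 1"
  using tau_range by (auto simp: T_def)

lemma T_plus1 [simp]: "T n (x + 1) = T n x"
  using tau_periodic[of "x - of_int n * \<alpha>"] by (simp add: T_def algebra_simps)

lemma T_shift: "T n (x + \<alpha>) = T (n - 1) x"
  by (simp add: T_def algebra_simps)

lemma T_lipschitz: "\<bar>T n x - T n x'\<bar> \<le> L * \<bar>x - x'\<bar>"
  using tau_lipschitz[of "x - of_int n * \<alpha>" "x' - of_int n * \<alpha>"] by (simp add: T_def)

lemma L_nonneg: "L \<ge> 0"
  using tau_lipschitz[of 1 0] abs_ge_zero order_trans by fastforce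

lemma T_mult_bounds:
  assumes "0 \<le> r" "r \<le> 1"
  shows "\<bar>T n x * r\<bar> \<le> 1" "0 \<le> T n x * r" "T n x * r \<le> 1"
proof -
  show "0 \<le> T n x * r" using T_range assms by simp
  moreover show "T n x * r \<le> 1" using T_range[of n x] assms by (simp add: mult_le_one)
  ultimately show "\<bar>T n x * r\<bar> \<le> 1" by simp
qed

lemma frac01: "0 \<le> frac u" "frac u \<le> 1" "0 \<le> 1 - frac u" "1 - frac u \<le> 1" for u :: real
  using frac_lt_1[of u] by (auto simp: less_imp_le)

lemma Gp_bounds: "Gp x y \<le> y" "y - 1/2 \<le> Gp x y"
  using wsum_bounds[of "\<lambda>n. T n x * frac (y - of_int n * \<beta>)" 1] T_mult_bounds frac01
  unfolding Gp_def by auto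

lemma Gm_bounds: "Gm x y \<le> y" "y - 1/2 \<le> Gm x y"
  using wsum_bounds[of "\<lambda>n. T n x * (1 - frac (of_int n * \<beta> - y))" 1] T_mult_bounds frac01
  unfolding Gm_def by auto

lemma Gp_minus_Gm:
  "Gp x y - Gm x y = wsum (\<lambda>n. if y - of_int n * \<beta> \<in> \<int> then T n x else 0)"
proof -
  have "Gp x y - Gm x y = wsum (\<lambda>n. T n x * (1 - frac (of_int n * \<beta> - y))) -
      wsum (\<lambda>n. T n x * frac (y - of_int n * \<beta>))"
    by (simp add: Gp_def Gm_def)
  also have "\<dots> = wsum (\<lambda>n. T n x * (1 - frac (of_int n * \<beta> - y)) - T n x * frac (y - of_int n * \<beta>))"
    by (rule wsum_diff[symmetric, where B = 1 and C = 1]) (use T_mult_bounds frac01 in auto)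
  also have "(\<lambda>n. T n x * (1 - frac (of_int n * \<beta> - y)) - T n x * frac (y - of_int n * \<beta>)) =
     (\<lambda>n. if y - of_int n * \<beta> \<in> \<int> then T n x else 0)"
  proof
    fix n
    have "T n x * (1 - frac (of_int n * \<beta> - y)) - T n x * frac (y - of_int n * \<beta>) =
        T n x * (1 - frac (- (y - of_int n * \<beta>)) - frac (y - of_int n * \<beta>))"
      by (simp add: algebra_simps)
    then show "T n x * (1 - frac (of_int n * \<beta> - y)) - T n x * frac (y - of_int n * \<beta>) =
       (if y - of_int n * \<beta> \<in> \<int> then T n x else 0)"
      unfolding frac_jump by simp
  qed
  finally show ?thesis .
qed

lemma orbit_unique:
  assumes "y - of_int n * \<beta> \<in> \<int>" "y - of_int k * \<beta> \<in> \<int>"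
  shows "k = n"
proof -
  have "(y - of_int n * \<beta>) - (y - of_int k * \<beta>) \<in> \<int>" using assms by (rule Ints_diff)
  then obtain m where "of_int (k - n) * \<beta> = of_int m" by (auto elim!: Ints_cases simp: algebra_simps)
  then show ?thesis using irr[of "k - n" m] by simp
qed

lemma jump_at_orbit:
  assumes "y - of_int n * \<beta> \<in> \<int>"
  shows "Gp x y - Gm x y = wt n * T n x"
proof -
  have "(\<lambda>k. if y - of_int k * \<beta> \<in> \<int> then T k x else 0) = (\<lambda>k. if k = n then T n x else 0)"
  proof
    fix k
    show "(if y - of_int k * \<beta> \<in> \<int> then T k x else 0) = (if k = n then T n x else 0)"
      using orbit_unique[OF assms, of k] assms by (cases "k = n") auto
  qed
  then show ?thesis by (simp only: Gp_minus_Gm wsum_single)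
qed

lemma no_jump:
  assumes "\<And>n. y - of_int n * \<beta> \<notin> \<int>"
  shows "Gp x y = Gm x y"
  using Gp_minus_Gm[of x y] assms by (simp add: wsum_def)

lemma Gm_le_Gp: "Gm x y \<le> Gp x y"
proof -
  have "0 \<le> wsum (\<lambda>n. if y - of_int n * \<beta> \<in> \<int> then T n x else 0)"
    by (rule wsum_bounds[where B = 1]) (use T_range in auto)
  then show ?thesis using Gp_minus_Gm[of x y] by linarith
qed

text \<open>From \<open>y\<close> to \<open>y'\<close> the identity gains \<open>y' - y\<close>,
  while each fractional part gains at most that much and the weights sum to at most 1/2. The
  remaining slope 1/2 is what makes \<phi> well defined and Lipschitz.\<close>

lemma Gp_less_Gm:
  assumes "y < y'"
  shows "Gp x y + (y' - y) / 2 \<le> Gm x y'"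
proof -
  have "wsum (\<lambda>n. T n x * (1 - frac (of_int n * \<beta> - y')))
      \<le> wsum (\<lambda>n. T n x * frac (y - of_int n * \<beta>) + T n x * (y' - y))"
  proof (rule wsum_mono)
    show "\<bar>T n x * (1 - frac (of_int n * \<beta> - y'))\<bar> \<le> 1" for n
      by (rule T_mult_bounds frac01)+
    show "\<bar>T n x * frac (y - of_int n * \<beta>) + T n x * (y' - y)\<bar> \<le> 1 + (y' - y)" for n
    proof -
      have "0 \<le> T n x * frac (y - of_int n * \<beta>)" "T n x * frac (y - of_int n * \<beta>) \<le> 1"
        by (rule T_mult_bounds frac01)+
      moreover have "0 \<le> T n x * (y' - y)" using T_range[of n x] assms by simp
      moreover have "T n x * (y' - y) \<le> y' - y" using T_range[of n x] assms by (simp add: mult_left_le_one_le)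
      ultimately show ?thesis by linarith
    qed
    show "T n x * (1 - frac (of_int n * \<beta> - y')) \<le> T n x * frac (y - of_int n * \<beta>) + T n x * (y' - y)" for n
      using left_limit_le_frac_add[of "y - of_int n * \<beta>" "y' - of_int n * \<beta>"] assms
        mult_left_mono[OF _ T_range(1)[of n x]]
      by (simp flip: distrib_left)
  qed
  also have "\<dots> = wsum (\<lambda>n. T n x * frac (y - of_int n * \<beta>)) + wsum (\<lambda>n. T n x * (y' - y))"
    by (rule wsum_add[where B = 1 and C = "y' - y"])
      (use T_mult_bounds frac01 T_range assms in \<open>auto simp: abs_mult mult_left_le_one_le\<close>)
  also have "wsum (\<lambda>n. T n x * (y' - y)) \<le> (y' - y) / 2"
    by (rule wsum_bounds) (use T_range assms in \<open>auto simp: mult_left_le_one_le\<close>)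
  finally show ?thesis unfolding Gm_def Gp_def by (simp add: field_simps)
qed

lemma Gp_less_Gm_strict: "y < y' \<Longrightarrow> Gp x y < Gm x y'"
  using Gp_less_Gm[of y y' x] by (simp add: field_simps)

lemma Gp_mono: "y \<le> y' \<Longrightarrow> Gp x y \<le> Gp x y'"
  using Gp_less_Gm_strict[of y y' x] Gm_le_Gp[of x y'] by (cases "y = y'") auto

lemma Gp_at_right: "(Gp x \<longlongrightarrow> Gp x y) (at_right y)"
proof -
  have 1: "((\<lambda>v. wsum (\<lambda>n. T n x * frac (v - of_int n * \<beta>))) \<longlongrightarrow>
      wsum (\<lambda>n. T n x * frac (y - of_int n * \<beta>))) (at_right y)"
  proof (rule wsum_tendsto)
    show "\<bar>T n x * frac (v - of_int n * \<beta>)\<bar> \<le> 1" for v n by (rule T_mult_bounds frac01)+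
    fix n
    have "filterlim (\<lambda>v. v - of_int n * \<beta>) (at_right (y - of_int n * \<beta>)) (at_right y)"
      by (auto simp: filterlim_at eventually_at_filter intro!: tendsto_eq_intros)
    from filterlim_compose[OF frac_at_right this]
    show "((\<lambda>v. T n x * frac (v - of_int n * \<beta>)) \<longlongrightarrow> T n x * frac (y - of_int n * \<beta>)) (at_right y)"
      by (intro tendsto_mult tendsto_const)
  qed
  show ?thesis unfolding Gp_def by (intro tendsto_diff 1 tendsto_ident_at)
qed

lemma Gp_at_left: "(Gp x \<longlongrightarrow> Gm x y) (at_left y)"
proof -
  have 1: "((\<lambda>v. wsum (\<lambda>n. T n x * frac (v - of_int n * \<beta>))) \<longlongrightarrow>
      wsum (\<lambda>n. T n x * (1 - frac (of_int n * \<beta> - y)))) (at_left y)"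
  proof (rule wsum_tendsto)
    show "\<bar>T n x * frac (v - of_int n * \<beta>)\<bar> \<le> 1" for v n by (rule T_mult_bounds frac01)+
    fix n
    have "filterlim (\<lambda>v. v - of_int n * \<beta>) (at_left (y - of_int n * \<beta>)) (at_left y)"
      by (auto simp: filterlim_at eventually_at_filter intro!: tendsto_eq_intros)
    from filterlim_compose[OF frac_at_left this]
    show "((\<lambda>v. T n x * frac (v - of_int n * \<beta>)) \<longlongrightarrow> T n x * (1 - frac (of_int n * \<beta> - y))) (at_left y)"
      by (intro tendsto_mult tendsto_const) simp
  qed
  show ?thesis unfolding Gp_def Gm_def by (intro tendsto_diff 1 tendsto_ident_at)
qed

text \<open>The intervals from \<open>Gm x y\<close> to \<open>Gp x y\<close> tile the line. They
  are disjoint by \<open>Gp_less_Gm_strict\<close>; they cover because, at the supremum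
  \<open>y\<close> of the points with \<open>Gp x y \<le> t\<close>, the one-sided limits of
  \<open>Gp x\<close> enclose \<open>t\<close>.\<close>

lemma ex1_phi: "\<exists>!y. Gm x y \<le> t \<and> t \<le> Gp x y"
proof (rule ex_ex1I)
  define S where "S = {y. Gp x y \<le> t}"
  have ne: "t \<in> S" using Gp_bounds by (simp add: S_def)
  have ub: "y \<le> t + 1/2" if "y \<in> S" for y using Gp_bounds(2)[of y x] that by (simp add: S_def)
  have bdd: "bdd_above S" using ub by (rule bdd_aboveI)
  define y where "y = Sup S"
  have "t \<le> Gp x y"
  proof (rule tendsto_lowerbound[OF Gp_at_right])
    show "\<forall>\<^sub>F v in at_right y. t \<le> Gp x v"
      using eventually_at_right_less[of y]
    proof eventually_elim
      case (elim v)
      then have "v \<notin> S" using cSup_upper[OF _ bdd, of v] by (auto simp: y_def)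
      then show ?case by (simp add: S_def)
    qed
  qed simp
  moreover have "Gm x y \<le> t"
  proof (rule tendsto_upperbound[OF Gp_at_left])
    have "\<forall>\<^sub>F v in at_left y. v \<in> {y - 1<..<y}" by (rule eventually_at_left_real) simp
    then show "\<forall>\<^sub>F v in at_left y. Gp x v \<le> t"
    proof eventually_elim
      case (elim v)
      then obtain v' where "v' \<in> S" "v < v'"
        using less_cSup_iff[OF _ bdd, of v] ne by (auto simp: y_def)
      then show ?case using Gp_mono[of v v' x] by (auto simp: S_def)
    qed
  qed simp
  ultimately show "\<exists>y. Gm x y \<le> t \<and> t \<le> Gp x y" by blast
next
  fix y y' assume "Gm x y \<le> t \<and> t \<le> Gp x y" "Gm x y' \<le> t \<and> t \<le> Gp x y'"
  then show "y = y'" using Gp_less_Gm_strict[of y y' x] Gp_less_Gm_strict[of y' y x]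
    by (cases y y' rule: linorder_cases) auto
qed

lemma phi_le: "Gm x (\<phi> x t) \<le> t" and phi_ge: "t \<le> Gp x (\<phi> x t)"
  using theI'[OF ex1_phi[of x t]] unfolding \<phi>_def by auto

lemma phi_eqI: "Gm x y \<le> t \<Longrightarrow> t \<le> Gp x y \<Longrightarrow> \<phi> x t = y"
  using ex1_phi[of x t] phi_le phi_ge by blast

lemma phi_eq_iff: "\<phi> x t = y \<longleftrightarrow> Gm x y \<le> t \<and> t \<le> Gp x y"
  using phi_eqI phi_le phi_ge by blast

lemma Gp_plus1: "Gp x (y + 1) = Gp x y + 1" "Gp (x + 1) y = Gp x y"
proof -
  have "y + 1 - of_int n * \<beta> = (y - of_int n * \<beta>) + 1" for n by simp
  then show "Gp x (y + 1) = Gp x y + 1" by (simp only: Gp_def frac_1_eq)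
qed (simp add: Gp_def)

lemma frac_minus1: "frac (u - 1) = frac u" for u :: real
  using frac_1_eq[of "u - 1"] by simp

lemma Gm_plus1: "Gm x (y + 1) = Gm x y + 1" "Gm (x + 1) y = Gm x y"
proof -
  have "of_int n * \<beta> - (y + 1) = (of_int n * \<beta> - y) - 1" for n by simp
  then show "Gm x (y + 1) = Gm x y + 1" by (simp only: Gm_def frac_minus1)
qed (simp add: Gm_def)

lemma phi_plus1: "\<phi> x (t + 1) = \<phi> x t + 1" "\<phi> (x + 1) t = \<phi> x t"
  by (rule phi_eqI; use phi_le phi_ge Gp_plus1 Gm_plus1 in simp)+

lemma phi_bounds: "t \<le> \<phi> x t" "\<phi> x t \<le> t + 1/2"
  using phi_le[of x t] phi_ge[of t x] Gp_bounds[of x "\<phi> x t"] Gm_bounds[of "\<phi> x t" x] by linarith+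

lemma Gp_lipschitz: "\<bar>Gp x y - Gp x' y\<bar> \<le> L * \<bar>x - x'\<bar> / 2"
proof -
  have "\<bar>wsum (\<lambda>n. T n x' * frac (y - of_int n * \<beta>)) - wsum (\<lambda>n. T n x * frac (y - of_int n * \<beta>))\<bar>
     \<le> (L * \<bar>x - x'\<bar>) / 2"
  proof (rule wsum_abs_diff_le)
    show "\<bar>T n x * frac (y - of_int n * \<beta>)\<bar> \<le> 1" for n x by (rule T_mult_bounds frac01)+
    show "\<bar>T n x * frac (y - of_int n * \<beta>)\<bar> \<le> 1" for n x by (rule T_mult_bounds frac01)+
    show "\<bar>T n x' * frac (y - of_int n * \<beta>) - T n x * frac (y - of_int n * \<beta>)\<bar> \<le> L * \<bar>x - x'\<bar>" for n
      using T_lipschitz[of n x x'] frac01[of "y - of_int n * \<beta>"]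
        mult_mono[of "\<bar>T n x' - T n x\<bar>" "L * \<bar>x - x'\<bar>" "frac (y - of_int n * \<beta>)" 1]
      by (simp add: abs_mult abs_minus_commute flip: left_diff_distrib)
  qed
  then show ?thesis by (simp add: Gp_def)
qed

text \<open>Changing the fibre perturbs \<open>Gp\<close> by at most
  \<open>L * \<bar>x - x'\<bar> / 2\<close>. Since \<open>Gp x\<close> has slope at least 1/2, this
  error and the change of \<open>t\<close> are at most doubled in the inverse. The other inequality
  follows by exchanging the roles.\<close>

lemma phi_lipschitz_aux:
  "\<phi> x t \<le> \<phi> x' t' + 2 * (L * \<bar>x - x'\<bar> / 2 + \<bar>t - t'\<bar>)"
proof (rule field_le_epsilon)
  fix e :: real assume e: "e > 0"
  show "\<phi> x t \<le> \<phi> x' t' + 2 * (L * \<bar>x - x'\<bar> / 2 + \<bar>t - t'\<bar>) + e"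
  proof (rule ccontr)
    assume *: "\<not> ?thesis"
    have nn: "0 \<le> L * \<bar>x - x'\<bar>" using L_nonneg by simp
    define y where "y = \<phi> x' t'"
    have less: "y < \<phi> x t" using * e nn unfolding y_def by argo
    have "Gp x y + (\<phi> x t - y) / 2 \<le> t" using Gp_less_Gm[OF less, of x] phi_le[of x t] by linarith
    moreover have "t' \<le> Gp x' y" using phi_ge y_def by simp
    moreover have "\<bar>Gp x y - Gp x' y\<bar> \<le> L * \<bar>x - x'\<bar> / 2" by (rule Gp_lipschitz)
    ultimately show False using * e unfolding y_def by argo
  qed
qed

lemma phi_continuous: "continuous_on UNIV (\<lambda>z. \<phi> (fst z) (snd z))"
proof -
  have "((\<lambda>z. \<phi> (fst z) (snd z)) \<longlongrightarrow> \<phi> (fst z0) (snd z0)) (at z0)" for z0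
  proof (rule Lim_transform_bound[where g="\<lambda>z. L * \<bar>fst z - fst z0\<bar> + 2 * \<bar>snd z - snd z0\<bar>", THEN LIM_zero_cancel])
    show "\<forall>\<^sub>F z in at z0. norm (\<phi> (fst z) (snd z) - \<phi> (fst z0) (snd z0))
        \<le> norm (L * \<bar>fst z - fst z0\<bar> + 2 * \<bar>snd z - snd z0\<bar>)"
    proof (intro always_eventually allI)
      fix z :: "real \<times> real"
      have "0 \<le> L * \<bar>fst z - fst z0\<bar>" using L_nonneg by simp
      then show "norm (\<phi> (fst z) (snd z) - \<phi> (fst z0) (snd z0))
        \<le> norm (L * \<bar>fst z - fst z0\<bar> + 2 * \<bar>snd z - snd z0\<bar>)"
        using phi_lipschitz_aux[of "fst z" "snd z" "fst z0" "snd z0"]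
          phi_lipschitz_aux[of "fst z0" "snd z0" "fst z" "snd z"]
        by (simp add: abs_minus_commute)
    qed
    show "((\<lambda>z. L * \<bar>fst z - fst z0\<bar> + 2 * \<bar>snd z - snd z0\<bar>) \<longlongrightarrow> 0) (at z0)"
      by (auto intro!: tendsto_eq_intros)
  qed
  then show ?thesis by (simp add: continuous_on_def)
qed

lemma phi_mono: "t \<le> t' \<Longrightarrow> \<phi> x t \<le> \<phi> x t'"
  using Gp_less_Gm_strict[of "\<phi> x t'" "\<phi> x t" x] phi_le[of x t] phi_ge[of t' x] by (cases "\<phi> x t \<le> \<phi> x t'") auto

text \<open>One has \<open>t = \<phi> x t - (\<Sum>n. wt n * v n x t)\<close>, and \<open>f\<close> replaces the weight \<open>wt n\<close> by
  \<open>wt (n + 1)\<close>, so that it maps the blow-up of \<open>n\<beta>\<close> over \<open>x\<close> affinely onto the blow-up of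
  \<open>(n + 1)\<beta>\<close> over \<open>x + \<alpha>\<close>.\<close>

definition v :: "int \<Rightarrow> real \<Rightarrow> real \<Rightarrow> real" where
  "v n x t = (let y = \<phi> x t in if y - of_int n * \<beta> \<in> \<int> then (Gp x y - t) / wt n
     else T n x * frac (y - of_int n * \<beta>))"

definition f :: "real \<Rightarrow> real \<Rightarrow> real" where
  "f x t = \<phi> x t + \<beta> - wsum (\<lambda>n. v (n - 1) x t)"

text \<open>The bounds are the right value and the left limit of the n-th summand: on an orbit point
  \<open>v\<close> runs through the whole jump, elsewhere the two bounds coincide.\<close>

lemma v_lower: "T n x * frac (\<phi> x t - of_int n * \<beta>) \<le> v n x t"
  and v_upper: "v n x t \<le> T n x * (1 - frac (of_int n * \<beta> - \<phi> x t))"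
proof -
  define y where "y = \<phi> x t"
  have *: "T n x * frac (y - of_int n * \<beta>) \<le> v n x t \<and> v n x t \<le> T n x * (1 - frac (of_int n * \<beta> - y))"
  proof (cases "y - of_int n * \<beta> \<in> \<int>")
    case True
    then have "- (y - of_int n * \<beta>) \<in> \<int>" by (rule Ints_minus)
    then have fr: "frac (y - of_int n * \<beta>) = 0" "frac (of_int n * \<beta> - y) = 0" using True by simp_all
    have v: "v n x t = (Gp x y - t) / wt n" using True by (simp add: v_def y_def Let_def)
    show ?thesis unfolding fr v
      using jump_at_orbit[OF True, of x] phi_le[of x t] phi_ge[of t x] wt_pos[of n]
      by (simp add: y_def[symmetric] field_simps)
  next
    case False
    then show ?thesis using frac_jump[of "y - of_int n * \<beta>"] 
      by (simp add: v_def y_def[symmetric] Let_def)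
  qed
  then show "T n x * frac (\<phi> x t - of_int n * \<beta>) \<le> v n x t" 
    and "v n x t \<le> T n x * (1 - frac (of_int n * \<beta> - \<phi> x t))" by (auto simp: y_def)
qed

lemma v_bounds: "0 \<le> v n x t" "v n x t \<le> 1" "\<bar>v n x t\<bar> \<le> 1"
  using v_lower[of n x t] v_upper[of n x t] T_mult_bounds[OF frac01(1,2), of n x "\<phi> x t - of_int n * \<beta>"]
    T_mult_bounds[OF frac01(3,4), of n x "of_int n * \<beta> - \<phi> x t"] by linarith+

text \<open>By \<open>T_shift\<close>, moving the index by one turns the bounds on \<open>v\<close>
  into the summands of \<open>Gp\<close> and \<open>Gm\<close> over \<open>x + \<alpha>\<close> at
  height \<open>\<phi> x t + \<beta>\<close>, so \<open>f x t\<close> lies in the interval on which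
  \<phi> takes that value.\<close>

lemma phi_f: "\<phi> (x + \<alpha>) (f x t) = \<phi> x t + \<beta>"
proof (rule phi_eqI)
  have shift: "\<phi> x t + \<beta> - of_int n * \<beta> = \<phi> x t - of_int (n - 1) * \<beta>"
    "of_int n * \<beta> - (\<phi> x t + \<beta>) = of_int (n - 1) * \<beta> - \<phi> x t" for n
    by (simp_all add: algebra_simps)
  have "wsum (\<lambda>n. v (n - 1) x t) \<le> wsum (\<lambda>n. T n (x + \<alpha>) * (1 - frac (of_int n * \<beta> - (\<phi> x t + \<beta>))))"
    unfolding T_shift shift
    by (rule wsum_mono[where B = 1 and C = 1]) (rule v_bounds v_upper T_mult_bounds frac01)+
  then show "Gm (x + \<alpha>) (\<phi> x t + \<beta>) \<le> f x t" by (simp add: Gm_def f_def)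
  have "wsum (\<lambda>n. T n (x + \<alpha>) * frac (\<phi> x t + \<beta> - of_int n * \<beta>)) \<le> wsum (\<lambda>n. v (n - 1) x t)"
    unfolding T_shift shift
    by (rule wsum_mono[where B = 1 and C = 1]) (rule v_bounds v_lower T_mult_bounds frac01)+
  then show "f x t \<le> Gp (x + \<alpha>) (\<phi> x t + \<beta>)" by (simp add: Gp_def f_def)
qed

text \<open>Points with different \<phi>-values keep their order by \<open>phi_f\<close>. Points
  with the same value lie in one blown-up interval, where only the coordinate \<open>v n\<close> of
  that interval changes, strictly decreasing in \<open>t\<close>.\<close>

lemma f_strict_mono:
  assumes "t < t'"
  shows "f x t < f x t'"
proof (cases "\<phi> x t = \<phi> x t'")
  case True
  define y where "y = \<phi> x t"
  have "Gm x y < Gp x y"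
    using phi_le[of x t] phi_ge[of t' x] True assms by (simp add: y_def)
  then obtain n where n: "y - of_int n * \<beta> \<in> \<int>" using no_jump[of y x] by auto
  have "wsum (\<lambda>n. v (n - 1) x t') < wsum (\<lambda>n. v (n - 1) x t)"
  proof (rule wsum_strict_mono)
    show "\<bar>v (n - 1) x t'\<bar> \<le> 1" "\<bar>v (n - 1) x t\<bar> \<le> 1" for n using v_bounds by auto
    show "v (k - 1) x t' \<le> v (k - 1) x t" for k
      using assms wt_pos[of "k - 1"] True by (auto simp: v_def Let_def divide_right_mono)
    \<comment> \<open>In \<open>f\<close> the coordinate with index \<open>n\<close> carries the
      weight \<open>wt (n + 1)\<close>, so the strict inequality sits at summand
      \<open>n + 1\<close>.\<close>
    show "v (n + 1 - 1) x t' < v (n + 1 - 1) x t"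
      using assms wt_pos[of n] True n by (auto simp: v_def Let_def y_def divide_strict_right_mono)
  qed
  then show ?thesis using True by (simp add: f_def)
next
  case False
  then have "\<phi> x t < \<phi> x t'" using phi_mono[of t t' x] assms by simp
  then have "Gp (x + \<alpha>) (\<phi> x t + \<beta>) < Gm (x + \<alpha>) (\<phi> x t' + \<beta>)"
    using Gp_less_Gm_strict[of "\<phi> x t + \<beta>" "\<phi> x t' + \<beta>" "x + \<alpha>"] by simp
  then show ?thesis
    using phi_le[of "x + \<alpha>" "f x t'"] phi_ge[of "f x t" "x + \<alpha>"] by (simp add: phi_f)
qed

lemma v_plus1: "v n x (t + 1) = v n x t" "v n (x + 1) t = v n x t"
proof -
  have "\<phi> x t + 1 - of_int n * \<beta> \<in> \<int> \<longleftrightarrow> \<phi> x t - of_int n * \<beta> \<in> \<int>"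
    using Ints_add[of "\<phi> x t - of_int n * \<beta>" 1] Ints_diff[of "\<phi> x t + 1 - of_int n * \<beta>" 1]
    by (auto simp: algebra_simps)
  moreover have "frac (\<phi> x t + 1 - of_int n * \<beta>) = frac (\<phi> x t - of_int n * \<beta>)"
    using frac_1_eq[of "\<phi> x t - of_int n * \<beta>"] by (simp add: algebra_simps)
  ultimately show "v n x (t + 1) = v n x t" by (simp add: v_def Let_def phi_plus1 Gp_plus1)
  show "v n (x + 1) t = v n x t" by (simp add: v_def Let_def phi_plus1 Gp_plus1)
qed

lemma f_plus1: "f x (t + 1) = f x t + 1" "f (x + 1) t = f x t"
  by (simp_all add: f_def v_plus1 phi_plus1)

text \<open>The right-hand side is continuous in \<open>(x, t)\<close>, also where \<open>T n x\<close> tends to 0 and the jump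
  disappears; this is what makes \<open>f\<close> jointly continuous.\<close>

lemma v_local:
  assumes "\<bar>\<phi> x t - (of_int n * \<beta> + of_int m)\<bar> < 1"
  shows "v n x t = max 0 (min (T n x) ((Gp x (of_int n * \<beta> + of_int m) - t) / wt n)) +
     T n x * (\<phi> x t - (of_int n * \<beta> + of_int m))"
proof -
  define y where "y = \<phi> x t"
  define c where "c = of_int n * \<beta> + of_int m"
  have jump: "Gp x c - Gm x c = wt n * T n x" by (rule jump_at_orbit) (simp add: c_def)
  have t: "Gm x y \<le> t" "t \<le> Gp x y" using phi_le phi_ge by (auto simp: y_def)
  have w: "wt n > 0" by (rule wt_pos)
  have a: "\<bar>y - c\<bar> < 1" using assms by (simp add: y_def c_def)
  have yn: "y - of_int n * \<beta> = (y - c) + of_int m" by (simp add: c_def)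
  \<comment> \<open>At \<open>c\<close> the clamp is inactive; to the left it saturates at the jump
    size \<open>T n x\<close>, which accounts for the extra 1 in the fractional part, and to the
    right at 0.\<close>
  consider "y = c" | "y < c" | "y > c" by linarith
  then have "v n x t = max 0 (min (T n x) ((Gp x c - t) / wt n)) + T n x * (y - c)"
  proof cases
    case 1
    then have "y - of_int n * \<beta> \<in> \<int>" by (simp add: c_def)
    then have "v n x t = (Gp x c - t) / wt n" using 1 by (simp add: v_def y_def[symmetric] Let_def)
    moreover have "0 \<le> (Gp x c - t) / wt n" "(Gp x c - t) / wt n \<le> T n x"
      using t jump 1 w by (auto simp: field_simps)
    ultimately show ?thesis using 1 by simp
  next
    case 2
    have fr: "frac (y - of_int n * \<beta>) = 1 + (y - c)"
      unfolding frac_unique_iff yn using a 2 by simp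
    then have "y - of_int n * \<beta> \<notin> \<int>" using a by (simp flip: frac_gt_0_iff)
    then have v: "v n x t = T n x * (1 + (y - c))" using fr by (simp add: v_def y_def[symmetric] Let_def)
    have "t \<le> Gm x c" using t(2) Gp_less_Gm_strict[OF 2, of x] by linarith
    then have "T n x \<le> (Gp x c - t) / wt n" using jump w by (simp add: field_simps)
    then show ?thesis using v T_range[of n x] by (simp add: distrib_left)
  next
    case 3
    have fr: "frac (y - of_int n * \<beta>) = y - c"
      unfolding frac_unique_iff yn using a 3 by simp
    then have "y - of_int n * \<beta> \<notin> \<int>" using 3 by (simp flip: frac_gt_0_iff)
    then have v: "v n x t = T n x * (y - c)" using fr by (simp add: v_def y_def[symmetric] Let_def)
    have "Gp x c \<le> t" using t(1) Gp_less_Gm_strict[OF 3, of x] by linarith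
    then have "(Gp x c - t) / wt n \<le> 0" using w by (simp add: field_simps)
    then show ?thesis using v T_range[of n x] by simp
  qed
  then show ?thesis by (simp add: y_def c_def)
qed

lemma Gp_continuous: "continuous_on UNIV (\<lambda>x. Gp x y)"
  and T_continuous: "continuous_on UNIV (T n)"
proof -
  have "(\<lambda>x. Gp x y) \<midarrow>x0\<rightarrow> Gp x0 y" for x0
  proof (rule Lim_transform_bound[where g="\<lambda>x. L * \<bar>x - x0\<bar> / 2", THEN LIM_zero_cancel])
    show "\<forall>\<^sub>F x in at x0. norm (Gp x y - Gp x0 y) \<le> norm (L * \<bar>x - x0\<bar> / 2)"
      using Gp_lipschitz L_nonneg by (intro always_eventually allI) simp
  qed (auto intro!: tendsto_eq_intros)
  then show "continuous_on UNIV (\<lambda>x. Gp x y)" by (simp add: continuous_on_def)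
  have "T n \<midarrow>x0\<rightarrow> T n x0" for x0
  proof (rule Lim_transform_bound[where g="\<lambda>x. L * \<bar>x - x0\<bar>", THEN LIM_zero_cancel])
    show "\<forall>\<^sub>F x in at x0. norm (T n x - T n x0) \<le> norm (L * \<bar>x - x0\<bar>)"
      using T_lipschitz L_nonneg by (intro always_eventually allI) simp
  qed (auto intro!: tendsto_eq_intros)
  then show "continuous_on UNIV (T n)" by (simp add: continuous_on_def)
qed

text \<open>Each set \<open>A m\<close> is a neighbourhood of one translate of n\<beta> on which
  \<open>v_local\<close> applies. These sets overlap and cover the plane, because rounding down
  leaves a distance below 1.\<close>

lemma v_continuous: "continuous_on UNIV (\<lambda>z. v n (fst z) (snd z))"
proof -
  define A where "A m = {z. \<bar>\<phi> (fst z) (snd z) - (of_int n * \<beta> + of_int m)\<bar> < 1}" for m :: int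
  have op: "open (A m)" for m
    unfolding A_def by (intro open_Collect_less continuous_intros phi_continuous)
  have co: "continuous_on (A m) (\<lambda>z. v n (fst z) (snd z))" for m
  proof -
    have [continuous_intros]: "continuous_on (A m) (\<lambda>z. Gp (fst z) c)" "continuous_on (A m) (\<lambda>z. T n (fst z))" for c
      by (rule continuous_on_compose2[OF Gp_continuous continuous_on_fst[OF continuous_on_id]]
          continuous_on_compose2[OF T_continuous continuous_on_fst[OF continuous_on_id]], simp)+
    have "continuous_on (A m) (\<lambda>z. max 0 (min (T n (fst z)) ((Gp (fst z) (of_int n * \<beta> + of_int m) - snd z) / wt n)) +
       T n (fst z) * (\<phi> (fst z) (snd z) - (of_int n * \<beta> + of_int m)))"
      using wt_pos[of n]
      by (intro continuous_intros continuous_on_subset[OF phi_continuous]) auto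
    then show ?thesis
      by (rule continuous_on_eq) (simp add: A_def v_local)
  qed
  have "(\<Union>m. A m) = UNIV"
  proof -
    have "z \<in> A \<lfloor>\<phi> (fst z) (snd z) - of_int n * \<beta>\<rfloor>" for z by (simp add: A_def) linarith
    then show ?thesis by blast
  qed
  moreover have "continuous_on (\<Union>m. A m) (\<lambda>z. v n (fst z) (snd z))"
    using op co by (intro continuous_on_open_UN) auto
  ultimately show ?thesis by simp
qed

lemma f_continuous: "continuous_on UNIV (\<lambda>z. f (fst z) (snd z))"
  unfolding f_def
  by (intro continuous_intros phi_continuous continuous_on_wsum[where B = 1] v_bounds v_continuous)

end

subsection \<open>Lifts and quotient maps of the torus\<close>

definition circ :: "real \<Rightarrow> complex" where
  "circ t = cis (2 * pi * t)"

lemma proj_eq: "proj z = (circ (fst z), circ (snd z))"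
  by (simp add: proj_def circ_def)

lemma circ_eq_iff: "circ s = circ t \<longleftrightarrow> s - t \<in> \<int>"
proof -
  have "circ s = circ t \<longleftrightarrow> (\<exists>n::int. 2 * pi * s = 2 * pi * t + 2 * pi * of_int n)"
    unfolding circ_def cis_conv_exp exp_eq by (auto simp: complex_eq_iff)
  also have "\<dots> \<longleftrightarrow> (\<exists>n::int. s = t + of_int n)"
    by (simp flip: distrib_left)
  also have "\<dots> \<longleftrightarrow> s - t \<in> \<int>" 
    by (auto simp: Ints_def algebra_simps)
  finally show ?thesis .
qed

lemma circ_add_int: "m \<in> \<int> \<Longrightarrow> circ (t + m) = circ t"
  by (simp add: circ_eq_iff)

lemma norm_circ [simp]: "norm (circ t) = 1"
  by (simp add: circ_def)

lemma continuous_on_circ [continuous_intros]: "continuous_on S g \<Longrightarrow> continuous_on S (\<lambda>x. circ (g x))"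
  unfolding circ_def by (intro continuous_intros)

lemma circ_surj:
  assumes "norm u = 1"
  obtains t where "t \<in> {a..<a+1}" "u = circ t"
proof -
  define r where "r = Arg2pi u / (2 * pi)"
  have u: "circ r = u" using complex_norm_eq_1_exp[of u] assms by (simp add: cis_conv_exp circ_def r_def)
  have "r - (of_int \<lfloor>r - a\<rfloor>) \<in> {a..<a+1}" by simp linarith
  moreover have "u = circ (r - of_int \<lfloor>r - a\<rfloor>)" unfolding u[symmetric] circ_eq_iff by simp
  ultimately show ?thesis using that by blast
qed

lemma range_circ: "range circ = sphere 0 1"
  using circ_surj by (fastforce simp: dist_norm)

lemma circ_image_Icc: "circ ` {a..a+1} = sphere 0 1"
proof
  show "sphere 0 1 \<subseteq> circ ` {a..a+1}"
  proof
    fix u :: complex assume "u \<in> sphere 0 1"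
    then obtain t where "t \<in> {a..<a+1}" "u = circ t" using circ_surj[of u a] by auto
    then show "u \<in> circ ` {a..a+1}" by auto
  qed
qed auto

text \<open>An open arc is the complement of a compact one; this is how \<open>circ\<close> is seen
  to be an open map.\<close>

lemma circ_open_interval:
  assumes "a < b" "b < a + 1"
  shows "circ ` {a<..<b} = sphere 0 1 - circ ` {b..a+1}"
proof -
  have "circ s \<noteq> circ t" if "s \<in> {a<..<b}" "t \<in> {b..a+1}" for s t
  proof
    assume "circ s = circ t"
    then obtain m :: int where m: "s - t = of_int m" by (auto simp: circ_eq_iff elim: Ints_cases)
    with that assms have "of_int (- 1) < real_of_int m" "real_of_int m < of_int 0" by auto
    then have "- 1 < m" "m < 0" by (simp_all only: of_int_less_iff)
    then show False by linarith
  qed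
  then have disj: "circ ` {a<..<b} \<inter> circ ` {b..a+1} = {}" by fastforce
  have un: "sphere 0 1 = circ ` ({a<..<b} \<union> {b..a+1})"
  proof
    show "sphere 0 1 \<subseteq> circ ` ({a<..<b} \<union> {b..a+1})"
    proof
      fix u :: complex assume "u \<in> sphere 0 1"
      then obtain t where t: "t \<in> {a..<a+1}" "u = circ t" using circ_surj[of u a] by auto
      show "u \<in> circ ` ({a<..<b} \<union> {b..a+1})"
      proof (cases "t = a")
        case True
        then have "u = circ (a + 1)" using t circ_add_int[of 1 a] by simp
          then show ?thesis using assms by auto
      next
        case False
        then show ?thesis using t by auto
      qed
    qed
  qed auto
  show ?thesis unfolding un image_Un Un_Diff Diff_triv[OF disj] by simp
qed

lemma circ_open_map:
  assumes "open S"
  shows "openin (top_of_set (sphere 0 1)) (circ ` S)"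
proof (subst openin_subopen, safe)
  fix t assume "t \<in> S"
  then obtain d where d: "d > 0" "{t - d<..<t + d} \<subseteq> S"
    using assms by (auto simp: open_contains_ball ball_eq_greaterThanLessThan)
  \<comment> \<open>The arc has length at most 1/2, short of a full turn as
    \<open>circ_open_interval\<close> requires.\<close>
  define d' where "d' = min d (1/4)"
  have d': "d' > 0" "d' \<le> d" "d' \<le> 1/4" using d by (auto simp: d'_def)
  have "compact (circ ` {t + d'..(t - d') + 1})"
    by (intro compact_continuous_image continuous_intros compact_Icc)
  then have "openin (top_of_set (sphere 0 1)) (sphere 0 1 - circ ` {t + d'..(t - d') + 1})"
    by (intro openin_diff openin_subtopology_self) (auto intro!: closed_subset compact_imp_closed)
  moreover have "circ ` {t - d'<..<t + d'} = sphere 0 1 - circ ` {t + d'..(t - d') + 1}"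
    by (rule circ_open_interval) (use d' in auto)
  moreover have "circ ` {t - d'<..<t + d'} \<subseteq> circ ` S" using d d' by (intro image_mono) auto
  moreover have "circ t \<in> circ ` {t - d'<..<t + d'}" using d' by auto
  ultimately show "\<exists>T. openin (top_of_set (sphere 0 1)) T \<and> circ t \<in> T \<and> T \<subseteq> circ ` S"
    by metis
qed

lemma range_proj: "range proj = T2"
proof -
  have "range proj = range circ \<times> range circ" by (force simp: proj_eq image_iff)
  then show ?thesis by (simp add: range_circ T2_def)
qed

lemma proj_in_T2 [simp]: "proj z \<in> T2"
  using range_proj by auto

lemma T2_cases:
  assumes "p \<in> T2"
  obtains z where "p = proj z"
  using assms range_proj by blast

lemma proj_image_square: "proj ` ({0..1} \<times> {0..1}) = T2"
proof -
  have "proj ` ({0..1} \<times> {0..1}) = circ ` {0..1} \<times> circ ` {0..1}" by (force simp: proj_eq image_iff)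
  then show ?thesis using circ_image_Icc[of 0] by (simp add: T2_def)
qed

lemma continuous_on_proj [continuous_intros]: "continuous_on S g \<Longrightarrow> continuous_on S (\<lambda>x. proj (g x))"
  unfolding proj_eq by (intro continuous_intros)

lemma proj_eq_iff: "proj z = proj z' \<longleftrightarrow> fst z - fst z' \<in> \<int> \<and> snd z - snd z' \<in> \<int>"
  by (simp add: proj_eq circ_eq_iff)

lemma proj_eq_iff_translate: "proj z = proj z' \<longleftrightarrow> (\<exists>i j::int. z = z' + (of_int i, of_int j))"
proof
  assume "proj z = proj z'"
  then obtain i j :: int where "fst z - fst z' = of_int i" "snd z - snd z' = of_int j"
    by (auto simp: proj_eq_iff elim!: Ints_cases)
  then show "\<exists>i j::int. z = z' + (of_int i, of_int j)"
    by (intro exI[of _ i] exI[of _ j]) (simp add: prod_eq_iff algebra_simps)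
qed (auto simp: proj_eq_iff)

lemma compact_T2: "compact T2"
  by (simp add: T2_def compact_Times)

lemma closed_T2: "closed T2"
  by (simp add: compact_T2 compact_imp_closed)

lemma proj_open_map:
  assumes "open S"
  shows "openin (top_of_set T2) (proj ` S)"
proof (subst openin_subopen, intro ballI)
  fix p assume "p \<in> proj ` S"
  then obtain z where z: "z \<in> S" "p = proj z" by blast
  obtain A B where AB: "open A" "open B" "z \<in> A \<times> B" "A \<times> B \<subseteq> S"
    by (rule open_prod_elim[OF assms z(1)])
  have "openin (top_of_set T2) (circ ` A \<times> circ ` B)"
    unfolding T2_def by (intro openin_Times circ_open_map AB)
  moreover have "proj ` (A \<times> B) = circ ` A \<times> circ ` B" by (force simp: proj_eq image_iff)
  ultimately show "\<exists>T. openin (top_of_set T2) T \<and> p \<in> T \<and> T \<subseteq> proj ` S"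
    using AB z by (intro exI[of _ "proj ` (A \<times> B)"]) auto
qed

text \<open>A continuous map from a compact space to a Hausdorff space is closed, hence a quotient
  map onto its image. This is applied to the unit square over the torus and to its product with the
  homotopy parameter.\<close>

lemma continuous_on_compact_quotient:
  fixes q :: "'a::t2_space \<Rightarrow> 'b::t2_space" and h :: "'b \<Rightarrow> 'c::topological_space"
  assumes "compact X" "continuous_on X q" "q ` X = Y" "continuous_on X (h \<circ> q)"
  shows "continuous_on Y h"
  unfolding continuous_on_closed_invariant
proof (intro allI impI)
  fix C :: "'c set" assume C: "closed C"
  obtain D :: "'a set" where D: "closed D" "D \<inter> X = (h \<circ> q) -` C \<inter> X"
    using assms(4) C unfolding continuous_on_closed_invariant by blast
  have "compact (q ` (D \<inter> X))"
    using assms D by (intro compact_continuous_image continuous_on_subset[OF assms(2)] closed_Int_compact) auto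
  moreover have "q ` (D \<inter> X) \<inter> Y = h -` C \<inter> Y"
    unfolding D using assms(3) by auto
  ultimately show "\<exists>A. closed A \<and> A \<inter> Y = h -` C \<inter> Y"
    using compact_imp_closed by blast
qed

section \<open>Torus maps induced by equivariant maps of the plane\<close>

definition descend :: "(real \<times> real \<Rightarrow> real \<times> real) \<Rightarrow> complex \<times> complex \<Rightarrow> complex \<times> complex" where
  "descend F p = proj (F (SOME z. proj z = p))"

definition equivariant :: "(real \<times> real \<Rightarrow> real \<times> real) \<Rightarrow> bool" where
  "equivariant F \<longleftrightarrow> (\<forall>z. F (z + (1, 0)) = F z + (1, 0)) \<and> (\<forall>z. F (z + (0, 1)) = F z + (0, 1))"

text \<open>Stated for general vectors because \<open>w = 0\<close> gives invariance under all
  integer multiples of a period, and because in the plane the two lattice generators are treated one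
  after the other.\<close>

lemma add_int_of_add_one:
  fixes F :: "'a::real_vector \<Rightarrow> 'b::real_vector"
  assumes "\<And>z. F (z + v) = F z + w"
  shows "F (z + of_int k *\<^sub>R v) = F z + of_int k *\<^sub>R w"
proof -
  have nat: "F (z + of_nat n *\<^sub>R v) = F z + of_nat n *\<^sub>R w" for n z
  proof (induction n)
    case (Suc n)
    have "F (z + of_nat (Suc n) *\<^sub>R v) = F ((z + of_nat n *\<^sub>R v) + v)" by (simp add: algebra_simps)
    then show ?case by (simp only: assms Suc) (simp add: algebra_simps)
  qed simp
  show ?thesis
  proof (cases "k \<ge> 0")
    case True
    then obtain n where "k = int n" using nonneg_int_cases by blast
    then show ?thesis using nat by simp
  next
    case False
    then obtain n where "k = - int n" by (metis int_cases2 of_nat_0_le_iff)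
    then show ?thesis using nat[of "z - of_nat n *\<^sub>R v" n] by (simp add: algebra_simps)
  qed
qed

lemma equivariant_int:
  assumes "equivariant F"
  shows "F (z + (of_int i, of_int j)) = F z + (of_int i, of_int j)"
proof -
  have "F (z + (of_int i, of_int j)) = F ((z + of_int i *\<^sub>R (1, 0)) + of_int j *\<^sub>R (0, 1))"
    by (simp add: add.assoc)
  also have "\<dots> = F (z + of_int i *\<^sub>R (1, 0)) + of_int j *\<^sub>R (0, 1)"
    by (rule add_int_of_add_one) (use assms[unfolded equivariant_def] in blast)
  also have "F (z + of_int i *\<^sub>R (1, 0)) = F z + of_int i *\<^sub>R (1, 0)"
    by (rule add_int_of_add_one) (use assms[unfolded equivariant_def] in blast)
  finally show ?thesis by (simp add: add.assoc)
qed

lemma descend_proj: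
  assumes "equivariant F"
  shows "descend F (proj z) = proj (F z)"
proof -
  have "proj (SOME z'. proj z' = proj z) = proj z" by (rule someI) simp
  then obtain i j :: int where "(SOME z'. proj z' = proj z) = z + (of_int i, of_int j)"
    unfolding proj_eq_iff_translate by blast
  then have "F (SOME z'. proj z' = proj z) = F z + (of_int i, of_int j)"
    using equivariant_int[OF assms] by simp
  then show ?thesis unfolding descend_def proj_eq_iff_translate by blast
qed

lemma descend_in_T2 [simp]: "descend F p \<in> T2"
  by (simp add: descend_def)

lemma continuous_on_descend:
  assumes "equivariant F" "continuous_on UNIV F"
  shows "continuous_on T2 (descend F)"
proof (rule continuous_on_compact_quotient[where q = proj])
  show "compact ({0..1::real} \<times> {0..1::real})" by (intro compact_Times compact_Icc)
  have "continuous_on ({0..1::real} \<times> {0..1::real}) (\<lambda>z. proj (F z))"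
    using assms by (auto intro!: continuous_intros intro: continuous_on_subset)
  then show "continuous_on ({0..1::real} \<times> {0..1::real}) (descend F \<circ> proj)"
    by (simp add: o_def descend_proj[OF assms(1)])
  show "continuous_on ({0..1} \<times> {0..1}) proj"
    using continuous_on_proj[OF continuous_on_id] by simp
  show "proj ` ({0..1} \<times> {0..1}) = T2" by (rule proj_image_square)
qed

text \<open>Lifts of homeomorphisms of degree one that preserve the vertical fibration. They form
  a convex set, so that every one of them is isotopic to the identity.\<close>

definition fibred :: "(real \<Rightarrow> real) \<Rightarrow> (real \<Rightarrow> real \<Rightarrow> real) \<Rightarrow> bool" where
  "fibred A B \<longleftrightarrow> continuous_on UNIV A \<and> strict_mono A \<and> (\<forall>x. A (x + 1) = A x + 1) \<and>
     continuous_on UNIV (\<lambda>z. B (fst z) (snd z)) \<and> (\<forall>x. strict_mono (B x)) \<and>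
     (\<forall>x t. B x (t + 1) = B x t + 1 \<and> B (x + 1) t = B x t)"

definition fibmap :: "(real \<Rightarrow> real) \<Rightarrow> (real \<Rightarrow> real \<Rightarrow> real) \<Rightarrow> real \<times> real \<Rightarrow> real \<times> real" where
  "fibmap A B z = (A (fst z), B (fst z) (snd z))"

lemma surj_degree_one:
  fixes g :: "real \<Rightarrow> real"
  assumes "continuous_on UNIV g" "\<And>t. g (t + 1) = g t + 1"
  obtains t where "g t = s"
proof -
  \<comment> \<open>Over \<open>k\<close> periods \<open>g\<close> moves by exactly
    \<open>k\<close>, so its values at \<open>-k\<close> and \<open>k\<close> enclose
    \<open>s\<close>.\<close>
  define k where "k = \<lceil>\<bar>s - g 0\<bar>\<rceil>"
  have g: "g (of_int i) = g 0 + of_int i" for i :: int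
    using add_int_of_add_one[of g 1 1 0 i] assms by simp
  have k: "k \<ge> 0" "\<bar>s - g 0\<bar> \<le> of_int k" by (simp_all add: k_def)
  have "\<exists>t\<ge>of_int (-k). t \<le> of_int k \<and> g t = s"
    by (rule IVT') (use k g[of k] g[of "-k"] in \<open>auto intro: continuous_on_subset[OF assms(1)]\<close>)
  then show ?thesis using that by blast
qed

context
  fixes A B
  assumes fib: "fibred A B"
begin

lemma fibmap_equivariant: "equivariant (fibmap A B)"
  using fib by (auto simp: equivariant_def fibmap_def fibred_def)

lemma fibmap_continuous: "continuous_on UNIV (fibmap A B)"
  using fib unfolding fibmap_def fibred_def
  by (auto intro!: continuous_intros intro: continuous_on_compose2[of UNIV A])

lemma fibmap_inj: "fibmap A B z = fibmap A B z' \<Longrightarrow> z = z'"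
  using fib by (auto simp: fibmap_def fibred_def strict_mono_eq prod_eq_iff)

lemma fibmap_surj: obtains z where "fibmap A B z = z'"
proof -
  obtain x where x: "A x = fst z'"
    by (rule surj_degree_one[of A]) (use fib in \<open>auto simp: fibred_def\<close>)
  have "continuous_on UNIV (B x)"
    using continuous_on_compose2[of UNIV "\<lambda>z. B (fst z) (snd z)" UNIV "\<lambda>t. (x, t)"] fib
    by (auto simp: fibred_def continuous_on_Pair continuous_on_id continuous_on_const)
  then obtain t where t: "B x t = snd z'"
    by (rule surj_degree_one[of "B x"]) (use fib in \<open>auto simp: fibred_def\<close>)
  show ?thesis by (rule that[of "(x, t)"]) (simp add: fibmap_def x t)
qed

lemma descend_fibmap: "descend (fibmap A B) (proj z) = proj (fibmap A B z)"
  by (rule descend_proj[OF fibmap_equivariant])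

lemma descend_fibmap_inj:
  assumes "proj (fibmap A B z) = proj (fibmap A B z')"
  shows "proj z = proj z'"
proof -
  obtain i j :: int where "fibmap A B z = fibmap A B z' + (of_int i, of_int j)"
    using assms unfolding proj_eq_iff_translate by blast
  then have "z = z' + (of_int i, of_int j)"
    using fibmap_inj equivariant_int[OF fibmap_equivariant] by metis
  then show ?thesis unfolding proj_eq_iff_translate by blast
qed

lemma is_homeo_descend_fibmap: "is_homeo_T2 (descend (fibmap A B))"
proof -
  have "\<exists>g. homeomorphism T2 T2 (descend (fibmap A B)) g"
  proof (rule homeomorphism_compact[OF compact_T2])
    show "continuous_on T2 (descend (fibmap A B))"
      by (rule continuous_on_descend[OF fibmap_equivariant fibmap_continuous])
    show "descend (fibmap A B) ` T2 = T2"
    proof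
      show "T2 \<subseteq> descend (fibmap A B) ` T2"
      proof
        fix p assume "p \<in> T2"
        then obtain z' where z': "p = proj z'" by (rule T2_cases)
        obtain z where "fibmap A B z = z'" by (rule fibmap_surj)
        then show "p \<in> descend (fibmap A B) ` T2"
          using z' descend_fibmap[of z] proj_in_T2 by (metis image_eqI)
      qed
    qed auto
    show "inj_on (descend (fibmap A B)) T2"
      by (intro inj_onI) (metis T2_cases descend_fibmap descend_fibmap_inj)
  qed
  then show ?thesis by (simp add: is_homeo_T2_def)
qed

end

lemma fibred_id: "fibred (\<lambda>x. x) (\<lambda>x t. t)"
  by (auto simp: fibred_def strict_mono_def intro!: continuous_intros)

lemma strict_mono_convex:
  fixes f g :: "real \<Rightarrow> real"
  assumes "strict_mono f" "strict_mono g" "s \<in> {0..1}"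
  shows "strict_mono (\<lambda>x. (1 - s) * f x + s * g x)"
proof (rule strict_monoI)
  fix x y :: real assume "x < y"
  then have "f x < f y" "g x < g y" using assms by (auto simp: strict_mono_def)
  then show "(1 - s) * f x + s * g x < (1 - s) * f y + s * g y"
  proof (cases "s = 0")
    case False
    then have "s * g x < s * g y" using assms(3) \<open>g x < g y\<close> by simp
    moreover have "(1 - s) * f x \<le> (1 - s) * f y" using assms(3) \<open>f x < f y\<close> by (intro mult_left_mono) auto
    ultimately show ?thesis by linarith
  qed simp
qed

lemma fibred_convex:
  assumes "fibred A B" "fibred A' B'" "s \<in> {0..1}"
  shows "fibred (\<lambda>x. (1 - s) * A x + s * A' x) (\<lambda>x t. (1 - s) * B x t + s * B' x t)"
  unfolding fibred_def
proof (intro conjI allI)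
  show "strict_mono (\<lambda>x. (1 - s) * A x + s * A' x)" "strict_mono (\<lambda>t. (1 - s) * B x t + s * B' x t)" for x
    using assms unfolding fibred_def by (auto intro!: strict_mono_convex)
qed (use assms in \<open>auto simp: fibred_def algebra_simps intro!: continuous_intros\<close>)

text \<open>The straight-line homotopy of lifts runs through fibred maps. Joint continuity in
  parameter and point is obtained upstairs and passes through the compact quotient map.\<close>

lemma isotopic_to_id_fibmap:
  assumes "fibred A B"
  shows "isotopic_to_id (descend (fibmap A B))"
proof -
  define F where "F s = fibmap (\<lambda>x. (1 - s) * A x + s * x) (\<lambda>x t. (1 - s) * B x t + s * t)" for s
  have fib: "fibred (\<lambda>x. (1 - s) * A x + s * x) (\<lambda>x t. (1 - s) * B x t + s * t)" if "s \<in> {0..1}" for s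
    by (rule fibred_convex[OF assms fibred_id that])
  define h where "h = (\<lambda>(s, p). descend (F s) p)"
  have hp: "h (s, proj z) = proj (F s z)" if "s \<in> {0..1}" for s z
    using descend_fibmap[OF fib[OF that]] by (simp add: h_def F_def)
  have "continuous_on ({0..1} \<times> T2) h"
  proof (rule continuous_on_compact_quotient)
    let ?X = "{0..1::real} \<times> ({0..1::real} \<times> {0..1::real})"
    let ?q = "\<lambda>w. (fst w, proj (snd w))"
    show "compact ?X" by (intro compact_Times compact_Icc)
    show "continuous_on ?X ?q" by (intro continuous_intros)
    have "?q ` ?X = {0..1} \<times> proj ` ({0..1} \<times> {0..1})" by (force simp: image_iff)
    then show "?q ` ?X = {0..1} \<times> T2" by (simp add: proj_image_square)
    have [continuous_intros]: "continuous_on ?X (\<lambda>w. A (fst (snd w)))" "continuous_on ?X (\<lambda>w. B (fst (snd w)) (snd (snd w)))"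
      using assms unfolding fibred_def
      by (auto intro!: continuous_on_compose2[of UNIV A] continuous_on_compose2[of UNIV "\<lambda>z. B (fst z) (snd z)" _ snd] continuous_intros)
    have "continuous_on ?X (\<lambda>w. proj (F (fst w) (snd w)))"
      unfolding F_def fibmap_def by (intro continuous_intros)
    then show "continuous_on ?X (h \<circ> ?q)"
      by (rule continuous_on_eq) (auto simp: hp)
  qed
  then have cm: "continuous_map (prod_topology (top_of_set {0..1::real}) (top_of_set T2)) (top_of_set T2) h"
    by (auto simp: h_def case_prod_beta continuous_map_subtopology_eu prod_topology_subtopology_eu)
  have h0: "h (0, p) = descend (fibmap A B) p" for p by (simp add: h_def F_def)
  have h1: "h (1, p) = p" if "p \<in> T2" for p
    using that by (elim T2_cases) (simp add: hp F_def fibmap_def)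
  have P: "is_homeo_T2 (\<lambda>p. h (s, p))" if "s \<in> {0..1}" for s
    using is_homeo_descend_fibmap[OF fib[OF that]] by (simp add: h_def F_def)
  \<comment> \<open>The explicit form of \<open>homotopic_with\<close> is available only for a
    property that does not see values off the space.\<close>
  have cong: "is_homeo_T2 g \<longleftrightarrow> is_homeo_T2 g'" if eq: "\<And>p. p \<in> T2 \<Longrightarrow> g p = g' p" for g g'
    unfolding is_homeo_T2_def
  proof (intro ex_cong1 iffI)
    fix k
    show "homeomorphism T2 T2 g' k" if "homeomorphism T2 T2 g k"
      by (rule homeomorphism_cong[OF that]) (simp_all add: eq)
    show "homeomorphism T2 T2 g k" if "homeomorphism T2 T2 g' k"
      by (rule homeomorphism_cong[OF that]) (simp_all add: eq)
  qed
  have "\<exists>h. continuous_map (prod_topology (top_of_set {0..1::real}) (top_of_set T2)) (top_of_set T2) h \<and>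
        (\<forall>x\<in>topspace (top_of_set T2). h (0, x) = descend (fibmap A B) x) \<and>
        (\<forall>x\<in>topspace (top_of_set T2). h (1, x) = id x) \<and> (\<forall>t\<in>{0..1}. is_homeo_T2 (\<lambda>x. h (t, x)))"
  proof (intro exI[of _ h] conjI ballI)
    show "continuous_map (prod_topology (top_of_set {0..1::real}) (top_of_set T2)) (top_of_set T2) h" by (rule cm)
  qed (simp_all add: h0 h1 P)
  moreover have "is_homeo_T2 g \<longleftrightarrow> is_homeo_T2 g'"
    if "\<And>x. x \<in> topspace (top_of_set T2) \<Longrightarrow> g x = g' x" for g g'
    by (rule cong) (use that in simp)
  ultimately show ?thesis
    unfolding isotopic_to_id_def by (rule homotopic_with[THEN iffD2, rotated])
qed

subsection \<open>Minimal sets of maps semiconjugate to a rotation\<close>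

lemma rat_indep_exists: "\<exists>a b. rat_indep a b"
proof -
  obtain a :: real where irrational: "a \<notin> \<rat>"
    using uncountable_UNIV_real countable_rat by (metis UNIV_eq_I)
  have a: "i = 0 \<and> j = 0" if "of_int i + of_int j * a = 0" for i j :: int
  proof -
    have "j = 0"
    proof (rule ccontr)
      assume "j \<noteq> 0"
      then have "a = of_int (- i) / of_int j" using that by (simp add: field_simps)
      then have "a \<in> \<rat>" by (metis Rats_divide Rats_of_int)
      then show False using irrational by blast
    qed
    then show ?thesis using that by simp
  qed
  \<comment> \<open>These are the values that a relation with nonzero \<open>k\<close> would force
    on \<open>b\<close>; triples with \<open>k = 0\<close> only add the value 0.\<close>
  define X where "X = (\<lambda>(i, j, k). - (of_int i + of_int j * a) / of_int k) ` (UNIV :: (int \<times> int \<times> int) set)"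
  have "countable X" unfolding X_def by (intro countable_image) simp
  then obtain b where b: "b \<notin> X"
    using uncountable_UNIV_real by (metis UNIV_eq_I)
  have "rat_indep a b"
    unfolding rat_indep_def
  proof (intro allI impI)
    fix i j k :: int assume eq: "of_int i + of_int j * a + of_int k * b = 0"
    have "k = 0"
    proof (rule ccontr)
      assume "k \<noteq> 0"
      then have "b = - (of_int i + of_int j * a) / of_int k" using eq by (simp add: field_simps)
      then have "b \<in> X" unfolding X_def by (intro image_eqI[of _ _ "(i, j, k)"]) auto
      then show False using b by blast
    qed
    then show "i = 0 \<and> j = 0 \<and> k = 0" using a[of i j] eq by simp
  qed
  then show ?thesis by blast
qed

text \<open>With the reals regarded as a module over the integers, rational independence is linear
  independence of \<open>a\<close>, \<open>b\<close> and 1, the hypothesis of Kronecker's theorem.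
  The sign of \<open>k\<close> is not controlled.\<close>

lemma kronecker_torus:
  assumes "rat_indep a b" "\<epsilon> > 0"
  obtains k i j :: int where "\<bar>of_int k * a - of_int i - s\<bar> < \<epsilon>" "\<bar>of_int k * b - of_int j - t\<bar> < \<epsilon>"
proof -
  interpret Modules.module "(\<lambda>r. (*) (real_of_int r))"
    by (simp add: Modules.module.intro distrib_left mult.commute)
  have ri: "i = 0 \<and> j = 0 \<and> k = 0" if "of_int i + of_int j * a + of_int k * b = 0" for i j k :: int
    using assms that unfolding rat_indep_def by blast
  have neq: "a \<noteq> b" "a \<noteq> 1" "b \<noteq> 1" using ri[of 0 1 "-1"] ri[of 1 "-1" 0] ri[of 1 0 "-1"] by auto
  define \<theta> where "\<theta> n = (if n = 0 then a else if n = Suc 0 then b else 1)" for n :: nat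
  have set: "{..2::nat} = {0, Suc 0, 2}" by auto
  have im: "\<theta> ` {..2} = {a, b, 1}" unfolding set by (simp add: \<theta>_def insert_commute)
  have "independent {a, b, 1}"
  proof
    assume "dependent {a, b, 1}"
    then obtain u where u: "\<exists>v\<in>{a, b, 1}. u v \<noteq> 0" "(\<Sum>v\<in>{a, b, 1}. of_int (u v) * v) = 0"
      by (auto simp: dependent_finite)
    have "of_int (u 1) + of_int (u a) * a + of_int (u b) * b = 0"
      using u(2) neq by (simp add: algebra_simps)
    then show False using ri u(1) by blast
  qed
  then have ind: "independent (\<theta> ` {..2})" by (simp add: im)
  have inj: "inj_on \<theta> {..2}" unfolding set using neq by (auto simp: inj_on_def \<theta>_def)
  have theta2: "\<theta> 2 = 1" by (simp add: \<theta>_def)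
  obtain k m where km: "\<And>i. i < 2 \<Longrightarrow> \<bar>of_int k * \<theta> i - of_int (m i) - (if i = 0 then s else t)\<bar> < \<epsilon>"
    by (rule Kronecker_thm_2[OF ind inj theta2 assms(2), of "\<lambda>i. if i = 0 then s else t"]) blast
  show ?thesis using km[of 0] km[of 1] by (intro that[of k "m 0" "m 1"]) (auto simp: \<theta>_def)
qed

text \<open>Points whose \<open>H\<close>-fibre is a singleton have images under \<open>proj\<close> in every nonempty
  closed invariant set, since \<open>H\<close> descends to a semiconjugacy onto a minimal rotation. So the
  closure of these images is a minimal set as soon as such a point exists.\<close>

locale torus_semiconj =
  fixes A :: "real \<Rightarrow> real" and B :: "real \<Rightarrow> real \<Rightarrow> real"
    and H :: "real \<times> real \<Rightarrow> real \<times> real" and a b C :: real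
  assumes fib: "fibred A B"
    and H_continuous: "continuous_on UNIV H"
    and H_equivariant: "equivariant H"
    and H_near_id: "\<And>z. norm (H z - z) \<le> C"
    and semiconj: "\<And>z. H (fibmap A B z) = H z + (a, b)"
    and indep: "rat_indep a b"
begin

abbreviation "F \<equiv> fibmap A B"

definition singles :: "(real \<times> real) set" where
  "singles = {z. \<forall>z'. H z' = H z \<longrightarrow> z' = z}"

definition Mset :: "(complex \<times> complex) set" where
  "Mset = closure (proj ` singles)"

lemma H_iterate: "H ((F ^^ n) z) = H z + real n *\<^sub>R (a, b)"
  by (induction n) (simp_all add: semiconj algebra_simps flip: zero_prod_def)

text \<open>In the coordinate \<open>H\<close> the iterate is an exact translation; passing to that
  coordinate and back costs at most \<open>C\<close> at each end of the orbit.\<close>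

lemma displacement: "norm ((F ^^ n) z - z - real n *\<^sub>R (a, b)) \<le> 2 * C"
proof -
  have "(F ^^ n) z - z - real n *\<^sub>R (a, b) = (H z - z) - (H ((F ^^ n) z) - (F ^^ n) z)"
    by (simp add: H_iterate)
  also have "norm \<dots> \<le> C + C"
    by (rule order_trans[OF norm_triangle_ineq4 add_mono[OF H_near_id H_near_id]])
  finally show ?thesis by simp
qed

lemma rotation_set_F: "rotation_set F = {(a, b)}"
proof -
  have lim: "(\<lambda>k. inverse (real (n k)) *\<^sub>R ((F ^^ n k) (z k) - z k)) \<longlonglongrightarrow> (a, b)"
    if n: "filterlim n at_top sequentially" for n :: "nat \<Rightarrow> nat" and z
  proof (rule Lim_transform_bound[where g = "\<lambda>k. 2 * C * inverse (real (n k))", THEN LIM_zero_cancel])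
    have "\<forall>\<^sub>F k in sequentially. n k > 0"
      by (rule n[unfolded filterlim_iff, rule_format, OF eventually_gt_at_top])
    then show "\<forall>\<^sub>F k in sequentially. norm (inverse (real (n k)) *\<^sub>R ((F ^^ n k) (z k) - z k) - (a, b))
        \<le> norm (2 * C * inverse (real (n k)))"
    proof eventually_elim
      case (elim k)
      have "inverse (real (n k)) *\<^sub>R ((F ^^ n k) (z k) - z k) - (a, b) =
          inverse (real (n k)) *\<^sub>R ((F ^^ n k) (z k) - z k - real (n k) *\<^sub>R (a, b))"
        using elim by (simp add: scaleR_right_diff_distrib prod_eq_iff)
      then have "norm (inverse (real (n k)) *\<^sub>R ((F ^^ n k) (z k) - z k) - (a, b)) =
          inverse (real (n k)) * norm ((F ^^ n k) (z k) - z k - real (n k) *\<^sub>R (a, b))"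
        by simp
      also have "\<dots> \<le> inverse (real (n k)) * (2 * C)"
        by (intro mult_left_mono displacement) simp
      finally show ?case by (simp add: mult.commute)
    qed
    have "filterlim (\<lambda>k. real (n k)) at_top sequentially"
      by (rule filterlim_compose[OF filterlim_real_sequentially n])
    then have "(\<lambda>k. inverse (real (n k))) \<longlonglongrightarrow> 0"
      by (rule tendsto_inverse_0_at_top)
    then show "(\<lambda>k. 2 * C * inverse (real (n k))) \<longlonglongrightarrow> 0"
      by (rule tendsto_mult_right_zero)
  qed
  have uniq: "v = (a, b)" if v: "v \<in> rotation_set F" for v
  proof -
    obtain n z where n: "filterlim n at_top sequentially"
      and z: "(\<lambda>k. inverse (real (n k)) *\<^sub>R ((F ^^ n k) (z k) - z k)) \<longlonglongrightarrow> v"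
      using v unfolding rotation_set_def mem_Collect_eq by (elim exE conjE)
    show ?thesis by (rule LIMSEQ_unique[OF z lim[OF n]])
  qed
  have "(a, b) \<in> rotation_set F"
    unfolding rotation_set_def mem_Collect_eq
    by (rule exI[of _ "\<lambda>k. k"], rule exI[of _ "\<lambda>_. 0"], rule conjI[OF filterlim_ident lim[OF filterlim_ident]])
  then show ?thesis using uniq by (metis insertI1 is_singletonI' is_singleton_def singletonD empty_iff)
qed

lemma homeo_star_F: "homeo_star (descend F)"
proof -
  have "is_lift (descend F) F"
    using fibmap_continuous[OF fib] descend_fibmap[OF fib] by (simp add: is_lift_def)
  then show ?thesis
    unfolding homeo_star_def
    using is_homeo_descend_fibmap[OF fib] isotopic_to_id_fibmap[OF fib] rotation_set_F indep by blast
qed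

lemma dF_continuous: "continuous_on T2 (descend F)"
  by (rule continuous_on_descend[OF fibmap_equivariant[OF fib] fibmap_continuous[OF fib]])

lemma dH_proj: "descend H (proj z) = proj (H z)"
  by (rule descend_proj[OF H_equivariant])

text \<open>Kronecker's theorem supplies an integer \<open>k\<close> of unknown sign, so backward
  orbits inside \<open>N\<close> are needed too; they exist because \<open>N\<close> equals its
  image.\<close>

lemma invariant_orbit:
  assumes "descend F ` N = N" "N \<subseteq> T2" "proj z0 \<in> N"
  shows "\<exists>z. proj z \<in> N \<and> H z = H z0 + of_int k *\<^sub>R (a, b)"
proof -
  have pos: "\<exists>z. proj z \<in> N \<and> H z = H z0 + real n *\<^sub>R (a, b)" for n
  proof (induction n)
    case 0
    then show ?case using assms(3) by (intro exI[of _ z0]) (simp flip: zero_prod_def)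
  next
    case (Suc n)
    then obtain z where z: "proj z \<in> N" "H z = H z0 + real n *\<^sub>R (a, b)" by blast
    have "proj (F z) \<in> N" using z(1) assms(1) descend_fibmap[OF fib, of z] by (metis image_eqI)
    then show ?case using z(2) by (intro exI[of _ "F z"]) (simp add: semiconj algebra_simps)
  qed
  have neg: "\<exists>z. proj z \<in> N \<and> H z = H z0 - real n *\<^sub>R (a, b)" for n
  proof (induction n)
    case 0
    then show ?case using assms(3) by (intro exI[of _ z0]) (simp flip: zero_prod_def)
  next
    case (Suc n)
    then obtain z where z: "proj z \<in> N" "H z = H z0 - real n *\<^sub>R (a, b)" by blast
    \<comment> \<open>The value of \<open>H\<close> is prescribed in the plane, not only modulo the
      lattice, so an exact preimage is taken first and then identified with the one that lies in
      \<open>N\<close>.\<close>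
    obtain y where y: "F y = z" using fibmap_surj[OF fib] by blast
    obtain p where p: "p \<in> N" "descend F p = proj z" using assms(1) z(1) by (metis imageE)
    obtain w where w: "p = proj w" by (rule T2_cases[OF subsetD[OF assms(2) p(1)]])
    have "proj (F w) = proj (F y)" using p w y descend_fibmap[OF fib, of w] by simp
    then have "proj w = proj y" by (rule descend_fibmap_inj[OF fib])
    then have "proj y \<in> N" using p w by simp
    then show ?case using z(2) semiconj[of y] y by (intro exI[of _ y]) (simp add: algebra_simps)
  qed
  show ?thesis
  proof (cases "k \<ge> 0")
    case True
    then show ?thesis using pos[of "nat k"] by simp
  next
    case False
    obtain z where "proj z \<in> N" "H z = H z0 - real (nat (- k)) *\<^sub>R (a, b)" using neg by blast
    then show ?thesis using False by (intro exI[of _ z]) (simp add: prod_eq_iff)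
  qed
qed

text \<open>Under \<open>H\<close> an orbit in \<open>N\<close> becomes an orbit of the translation,
  dense modulo the lattice; compactness of \<open>N\<close> makes the image closed and turns density
  into surjectivity.\<close>

lemma image_invariant:
  assumes "descend F ` N = N" "N \<subseteq> T2" "N \<noteq> {}" "closed N"
  shows "descend H ` N = T2"
proof
  show "descend H ` N \<subseteq> T2" by auto
  have "compact N" using closed_Int_compact[OF assms(4) compact_T2] assms(2) by (simp add: Int_absorb2)
  moreover have "continuous_on N (descend H)"
    using continuous_on_descend[OF H_equivariant H_continuous] assms(2) continuous_on_subset by blast
  ultimately have cl: "closed (descend H ` N)"
    by (intro compact_imp_closed compact_continuous_image)
  obtain p0 where p0: "p0 \<in> N" using assms(3) by blast
  obtain z0 where "p0 = proj z0" by (rule T2_cases[OF subsetD[OF assms(2) p0]])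
  then have z0: "proj z0 \<in> N" using p0 by simp
  show "T2 \<subseteq> descend H ` N"
  proof
    fix p assume "p \<in> T2"
    then obtain w where w: "p = proj w" by (rule T2_cases)
    have "p \<in> closure (descend H ` N)"
      unfolding closure_approachable
    proof (intro allI impI)
      fix \<epsilon> :: real assume "\<epsilon> > 0"
      have "isCont proj w" using continuous_on_proj[OF continuous_on_id, of UNIV]
        by (metis UNIV_I continuous_on_eq_continuous_at open_UNIV)
      then obtain d where d: "d > 0" "\<And>w'. dist w' w < d \<Longrightarrow> dist (proj w') (proj w) < \<epsilon>"
        using \<open>\<epsilon> > 0\<close> unfolding continuous_at_eps_delta by blast
      obtain k i j :: int where k: "\<bar>of_int k * a - of_int i - (fst w - fst (H z0))\<bar> < d / 2"
          "\<bar>of_int k * b - of_int j - (snd w - snd (H z0))\<bar> < d / 2"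
        using kronecker_torus[OF indep, of "d / 2"] d(1) by (metis half_gt_zero)
      obtain z where z: "proj z \<in> N" "H z = H z0 + of_int k *\<^sub>R (a, b)"
        using invariant_orbit[OF assms(1,2) z0] by blast
      define w' where "w' = H z0 + of_int k *\<^sub>R (a, b) - (of_int i, of_int j)"
      have "H z = w' + (of_int i, of_int j)" by (simp add: z(2) w'_def)
      then have "proj (H z) = proj w'" unfolding proj_eq_iff_translate by blast
      then have "proj w' \<in> descend H ` N" using z(1) dH_proj[of z] by (metis image_eqI)
      moreover have "dist w' w < d"
      proof -
        have "dist w' w \<le> dist (fst w') (fst w) + dist (snd w') (snd w)"
          unfolding dist_prod_def using sqrt_sum_squares_le_sum[of "dist (fst w') (fst w)" "dist (snd w') (snd w)"] by simp
        also have "\<dots> < d / 2 + d / 2"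
          using k by (intro add_strict_mono) (simp_all add: w'_def dist_real_def algebra_simps)
        finally show ?thesis by simp
      qed
      ultimately show "\<exists>y\<in>descend H ` N. dist y p < \<epsilon>" using d(2) w by blast
    qed
    then show "p \<in> descend H ` N" using cl by (simp add: closure_closed)
  qed
qed

lemma singlesD: "z \<in> singles \<Longrightarrow> H z' = H z \<Longrightarrow> z' = z"
  unfolding singles_def by blast

lemma singlesI: "(\<And>z'. H z' = H z \<Longrightarrow> z' = z) \<Longrightarrow> z \<in> singles"
  unfolding singles_def by blast

lemma singles_F: "F z \<in> singles \<longleftrightarrow> z \<in> singles"
proof
  assume L: "F z \<in> singles"
  have "z' = z" if "H z' = H z" for z'
  proof (rule fibmap_inj[OF fib])
    have "H (F z') = H (F z)" using that by (simp add: semiconj)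
    then show "F z' = F z" by (rule singlesD[OF L])
  qed
  then show "z \<in> singles" by (rule singlesI)
next
  assume R: "z \<in> singles"
  have "z' = F z" if "H z' = H (F z)" for z'
  proof -
    obtain y where y: "F y = z'" by (rule fibmap_surj[OF fib])
    then have "H y = H z" using that semiconj[of y] semiconj[of z] by simp
    then show ?thesis using singlesD[OF R] y by blast
  qed
  then show "F z \<in> singles" by (rule singlesI)
qed

lemma dF_singles: "descend F ` (proj ` singles) = proj ` singles"
proof
  show "descend F ` (proj ` singles) \<subseteq> proj ` singles"
    by (intro image_subsetI, elim imageE) (simp add: descend_fibmap[OF fib] singles_F)
  show "proj ` singles \<subseteq> descend F ` (proj ` singles)"
  proof
    fix p assume "p \<in> proj ` singles"
    then obtain z where z: "z \<in> singles" "p = proj z" by blast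
    obtain y where y: "F y = z" by (rule fibmap_surj[OF fib])
    then have "y \<in> singles" using z singles_F by blast
    then show "p \<in> descend F ` (proj ` singles)"
      using z y descend_fibmap[OF fib, of y] by (metis image_eqI)
  qed
qed

lemma proj_singles_subset: "proj ` singles \<subseteq> Mset"
  by (simp add: Mset_def closure_subset)

lemma Mset_subset: "Mset \<subseteq> T2"
  unfolding Mset_def by (intro closure_minimal closed_T2 image_subsetI proj_in_T2)

lemma Mset_compact: "compact Mset"
  using closed_Int_compact[OF closed_closure compact_T2, of "proj ` singles"]
  unfolding Mset_def[symmetric] Int_absorb2[OF Mset_subset] .

lemma Mset_invariant: "descend F ` Mset = Mset"
proof
  have "continuous_on Mset (descend F)" using dF_continuous Mset_subset continuous_on_subset by blast
  then show "descend F ` Mset \<subseteq> Mset"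
    using proj_singles_subset dF_singles unfolding Mset_def
    by (intro image_closure_subset) simp_all
  have "compact (descend F ` Mset)"
    by (intro compact_continuous_image Mset_compact) fact
  then show "Mset \<subseteq> descend F ` Mset"
    using image_mono[OF proj_singles_subset, of "descend F"] dF_singles compact_imp_closed
    unfolding Mset_def by (intro closure_minimal) simp_all
qed

lemma singles_in_invariant:
  assumes "descend F ` N = N" "N \<subseteq> T2" "N \<noteq> {}" "closed N" "z \<in> singles"
  shows "proj z \<in> N"
proof -
  have "proj (H z) \<in> descend H ` N" using image_invariant[OF assms(1-4)] by simp
  then obtain p where p: "p \<in> N" "descend H p = proj (H z)" by auto
  obtain w where w: "p = proj w" by (rule T2_cases[OF subsetD[OF assms(2) p(1)]])
  then have "proj (H z) = proj (H w)" using p dH_proj by simp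
  then obtain i j :: int where "H z = H w + (of_int i, of_int j)" unfolding proj_eq_iff_translate by blast
  then have "H (w + (of_int i, of_int j)) = H z" using equivariant_int[OF H_equivariant] by simp
  then have "w + (of_int i, of_int j) = z" by (rule singlesD[OF assms(5)])
  then have "proj z = proj w" unfolding proj_eq_iff_translate by blast
  then show ?thesis using p w by simp
qed

lemma minimal_set_Mset:
  assumes "singles \<noteq> {}"
  shows "minimal_set (descend F) Mset"
  unfolding minimal_set_def
proof (intro conjI allI impI)
  show "Mset \<noteq> {}" using assms proj_singles_subset by blast
  show "closed Mset" by (simp add: Mset_def)
  fix N assume N: "N \<subseteq> Mset \<and> N \<noteq> {} \<and> closed N \<and> descend F ` N = N"
  then have NT: "N \<subseteq> T2" using Mset_subset by (meson subset_trans)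
  have "proj ` singles \<subseteq> N"
    by (rule image_subsetI, rule singles_in_invariant) (use N NT in \<open>simp_all\<close>)
  then have "Mset \<subseteq> N" unfolding Mset_def using N by (intro closure_minimal) simp_all
  then show "N = Mset" using N by (meson subset_antisym)
qed (rule Mset_subset Mset_invariant)+

end

section \<open>Components of the complement of the minimal set\<close>

lemma connected_openin_cases:
  assumes "connected C" "openin (top_of_set X) A" "openin (top_of_set X) B"
    and "C \<subseteq> A \<union> B" "A \<inter> B = {}"
  shows "C \<inter> A = {} \<or> C \<inter> B = {}"
proof -
  obtain A' B' where AB: "open A'" "A = X \<inter> A'" "open B'" "B = X \<inter> B'"
    using assms(2,3) unfolding openin_open by blast
  have "A' \<inter> C = {} \<or> B' \<inter> C = {}"
    by (rule connectedD[OF assms(1) AB(1,3)]) (use assms(4,5) AB(2,4) in blast)+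
  then show ?thesis using AB by blast
qed

text \<open>All members other than \<open>U n\<close> together form a relatively open set, so a
  component that meets \<open>U n\<close> cannot leave it.\<close>

lemma components_Union_disjoint_open:
  fixes U :: "'i \<Rightarrow> 'a::topological_space set"
  assumes op: "\<And>n. openin (top_of_set X) (U n)" and con: "\<And>n. connected (U n)"
    and disj: "\<And>n k. n \<noteq> k \<Longrightarrow> U n \<inter> U k = {}"
  shows "C \<in> components (\<Union>n. U n) \<Longrightarrow> \<exists>n. C = U n"
    and "U n \<noteq> {} \<Longrightarrow> U n \<in> components (\<Union>n. U n)"
proof -
  let ?Y = "\<Union>n. U n"
  have key: "C = U n" if C: "C \<in> components ?Y" and p: "p \<in> C" "p \<in> U n" for C n p
  proof
    show U: "U n \<subseteq> C"
      using components_maximal[OF C con[of n]] p by blast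
    have conC: "connected C" using C by (rule in_components_connected)
    have sub: "C \<subseteq> ?Y" using C by (rule in_components_subset)
    define V where "V = (\<Union>k\<in>-{n}. U k)"
    have opV: "openin (top_of_set X) V" unfolding V_def by (intro openin_Union) (use op in auto)
    have cov: "C \<subseteq> U n \<union> V"
    proof
      fix q assume "q \<in> C"
      then obtain k where "q \<in> U k" using sub by auto
      then show "q \<in> U n \<union> V" unfolding V_def by (cases "k = n") auto
    qed
    have "U n \<inter> U k = {}" if "k \<in> -{n}" for k using disj[of n k] that by auto
    then have "U n \<inter> V = {}" unfolding V_def by (simp add: Int_UN_distrib)
    with cov have "C \<inter> U n = {} \<or> C \<inter> V = {}"
      by (rule connected_openin_cases[OF conC op opV])
    moreover have "C \<inter> U n \<noteq> {}" using p by blast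
    ultimately show "C \<subseteq> U n" using cov by blast
  qed
  show "\<exists>n. C = U n" if C: "C \<in> components ?Y"
  proof -
    obtain p where p: "p \<in> C" using in_components_nonempty[OF C] by blast
    then obtain n where "p \<in> U n" using in_components_subset[OF C] by blast
    then show ?thesis using key[OF C p] by blast
  qed
  show "U n \<in> components ?Y" if ne: "U n \<noteq> {}"
  proof -
    obtain p where p: "p \<in> U n" using ne by blast
    then have "connected_component_set ?Y p \<in> components ?Y" by (auto simp: components_def)
    moreover have "p \<in> connected_component_set ?Y p" using p by auto
    ultimately show ?thesis using key[OF _ _ p] by metis
  qed
qed

context torus_semiconj
begin

lemma singles_translate:
  assumes "proj z = proj w" "z \<in> singles"
  shows "w \<in> singles"
proof (rule singlesI)
  fix z' assume eq: "H z' = H w"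
  obtain i j :: int where z: "z = w + (of_int i, of_int j)" using assms(1) unfolding proj_eq_iff_translate by blast
  have "H (z' + (of_int i, of_int j)) = H z" using eq z by (simp add: equivariant_int[OF H_equivariant])
  then have "z' + (of_int i, of_int j) = z" by (rule singlesD[OF assms(2)])
  then show "z' = w" using z by simp
qed

lemma closure_singles_Mset: "z \<in> closure singles \<Longrightarrow> proj z \<in> Mset"
  using image_closure_subset[OF continuous_on_proj[OF continuous_on_id] closed_closure closure_subset, of singles]
  unfolding Mset_def by blast

text \<open>Since \<open>singles\<close> is invariant under the lattice, disjointness in the plane
  persists after projection; as \<open>proj\<close> is open, it extends to the closure.\<close>

lemma open_disjoint_Mset:
  assumes "open W" "W \<inter> singles = {}"
  shows "proj ` W \<inter> Mset = {}"
proof -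
  have "closedin (top_of_set T2) (T2 - proj ` W)"
    by (rule closedin_diff[OF closedin_self proj_open_map[OF assms(1)]])
  then have "closed (T2 - proj ` W)" by (rule closedin_closed_trans[OF _ closed_T2])
  moreover have "proj ` singles \<subseteq> T2 - proj ` W"
  proof
    fix p assume "p \<in> proj ` singles"
    then obtain z where z: "z \<in> singles" "p = proj z" by blast
    have "p \<notin> proj ` W"
    proof
      assume "p \<in> proj ` W"
      then obtain w where w: "w \<in> W" "p = proj w" by blast
      have "w \<in> singles" by (rule singles_translate[of z w]) (use z w in auto)
      then show False using w assms(2) by blast
    qed
    then show "p \<in> T2 - proj ` W" using z by simp
  qed
  ultimately have "Mset \<subseteq> T2 - proj ` W" unfolding Mset_def by (rule closure_minimal[rotated])
  then show ?thesis by blast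
qed

text \<open>Moves the computation of the complement to the plane, where the open sets (lenses or
  horizontal strips) and the singleton fibres have explicit descriptions.\<close>

lemma complement_Mset:
  assumes "\<And>n. open (W n)" "\<And>n. W n \<inter> singles = {}"
    and "\<And>z. z \<notin> closure singles \<Longrightarrow> proj z \<in> (\<Union>n. proj ` W n)"
  shows "T2 - Mset = (\<Union>n. proj ` W n)"
proof
  show "T2 - Mset \<subseteq> (\<Union>n. proj ` W n)"
  proof
    fix p assume p: "p \<in> T2 - Mset"
    then obtain z where z: "p = proj z" using T2_cases by (metis DiffD1)
    then have "z \<notin> closure singles" using p closure_singles_Mset by blast
    then show "p \<in> (\<Union>n. proj ` W n)" using assms(3) z by blast
  qed
  show "(\<Union>n. proj ` W n) \<subseteq> T2 - Mset"
    using open_disjoint_Mset[OF assms(1,2)] by (auto simp: disjoint_iff)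
qed

end

section \<open>Gaps and singleton fibres of the blow-up\<close>

context blowup
begin

definition fsingle :: "real \<Rightarrow> real set" where
  "fsingle x = {t. \<forall>t'. \<phi> x t' = \<phi> x t \<longrightarrow> t' = t}"

text \<open>Only the copy at height n\<beta>; the others are integer translates. The lower end is
  \<open>Gm\<close> by \<open>gap_eq\<close>, but this form displays continuity in \<open>x\<close>,
  which comes from \<open>Gp\<close> and \<open>T n\<close>.\<close>

definition gap :: "int \<Rightarrow> real \<Rightarrow> real set" where
  "gap n x = {Gp x (of_int n * \<beta>) - wt n * T n x <..< Gp x (of_int n * \<beta>)}"

lemma phi_Gp: "\<phi> x (Gp x y) = y" and phi_Gm: "\<phi> x (Gm x y) = y"
  by (rule phi_eqI; simp add: Gm_le_Gp)+

lemma gap_eq: "gap n x = {Gm x (of_int n * \<beta>) <..< Gp x (of_int n * \<beta>)}"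
  using jump_at_orbit[of "of_int n * \<beta>" n x] by (simp add: gap_def algebra_simps)

lemma phi_gap: "t \<in> gap n x \<Longrightarrow> \<phi> x t = of_int n * \<beta>"
  by (rule phi_eqI) (auto simp: gap_eq)

lemma gap_not_fsingle: "gap n x \<inter> fsingle x = {}"
proof -
  have "t \<notin> fsingle x" if "t \<in> gap n x" for t
  proof
    assume "t \<in> fsingle x"
    moreover have "\<phi> x (Gp x (of_int n * \<beta>)) = \<phi> x t" using phi_gap[OF that] phi_Gp by simp
    ultimately have "Gp x (of_int n * \<beta>) = t" unfolding fsingle_def by blast
    then show False using that by (simp add: gap_eq)
  qed
  then show ?thesis by blast
qed

text \<open>All but countably many \<open>y\<close> avoid every jump; there \<open>Gm\<close> and
  \<open>Gp\<close> coincide and the \<phi>-fibre is a single point.\<close>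

lemma regular_between:
  assumes "c < d"
  obtains y where "c < y" "y < d" "Gp x y \<in> fsingle x"
proof -
  define X where "X = (\<lambda>(n, m). of_int n * \<beta> + of_int m) ` (UNIV :: (int \<times> int) set)"
  have "countable X" unfolding X_def by (intro countable_image) simp
  moreover have "uncountable {c<..<d}" using assms by (simp add: uncountable_open_interval)
  ultimately obtain y where y: "y \<in> {c<..<d}" "y \<notin> X" by (meson countable_subset subsetI)
  have "y - of_int n * \<beta> \<notin> \<int>" for n
  proof
    assume "y - of_int n * \<beta> \<in> \<int>"
    then obtain m :: int where "y - of_int n * \<beta> = of_int m" by (auto elim: Ints_cases)
    then have "y = of_int n * \<beta> + of_int m" by simp
    then have "y \<in> X" unfolding X_def by (intro image_eqI[of _ _ "(n, m)"]) auto
    then show False using y by blast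
  qed
  then have eq: "Gp x y = Gm x y" by (rule no_jump)
  have "t = Gp x y" if "\<phi> x t = y" for t using that eq unfolding phi_eq_iff by simp
  then have "Gp x y \<in> fsingle x" by (auto simp: fsingle_def phi_Gp)
  then show ?thesis using that y by auto
qed

text \<open>With \<open>fsingle_left\<close> this shows that regular points accumulate at both ends
  of a blown-up interval from outside, so the closure of \<open>fsingle x\<close> omits no more than
  the open gaps.\<close>

lemma fsingle_right:
  assumes "\<epsilon> > 0"
  obtains t' where "t' \<in> fsingle x" "Gp x y < t'" "t' < Gp x y + \<epsilon>"
proof -
  have "\<forall>\<^sub>F v in at_right y. Gp x v < Gp x y + \<epsilon>"
    by (rule order_tendstoD(2)[OF Gp_at_right]) (use assms in simp)
  then obtain d where d: "d > y" "\<And>v. y < v \<Longrightarrow> v < d \<Longrightarrow> Gp x v < Gp x y + \<epsilon>"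
    unfolding eventually_at_right_field by blast
  obtain v where v: "y < v" "v < d" "Gp x v \<in> fsingle x" by (rule regular_between[OF d(1)])
  have "Gp x y < Gp x v" using Gp_less_Gm_strict[OF v(1), of x] Gm_le_Gp[of x v] by linarith
  then show ?thesis using that v d(2) by blast
qed

lemma fsingle_left:
  assumes "\<epsilon> > 0"
  obtains t' where "t' \<in> fsingle x" "Gm x y - \<epsilon> < t'" "t' < Gm x y"
proof -
  have "\<forall>\<^sub>F v in at_left y. Gm x y - \<epsilon> < Gp x v"
    by (rule order_tendstoD(1)[OF Gp_at_left]) (use assms in simp)
  then obtain d where d: "d < y" "\<And>v. d < v \<Longrightarrow> v < y \<Longrightarrow> Gm x y - \<epsilon> < Gp x v"
    unfolding eventually_at_left_field by blast
  obtain v where v: "d < v" "v < y" "Gp x v \<in> fsingle x" by (rule regular_between[OF d(1)])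
  then show ?thesis using that d(2) Gp_less_Gm_strict[OF v(2), of x] by blast
qed

lemma fsingle_islimpt_Gp: "Gp x y islimpt fsingle x"
  unfolding islimpt_approachable
proof (intro allI impI)
  fix \<epsilon> :: real assume "\<epsilon> > 0"
  then obtain t' where t': "t' \<in> fsingle x" "Gp x y < t'" "t' < Gp x y + \<epsilon>" by (rule fsingle_right)
  show "\<exists>t'\<in>fsingle x. t' \<noteq> Gp x y \<and> dist t' (Gp x y) < \<epsilon>"
    by (rule bexI[OF _ t'(1)]) (use t' in \<open>auto simp: dist_real_def\<close>)
qed

lemma fsingle_islimpt_Gm: "Gm x y islimpt fsingle x"
  unfolding islimpt_approachable
proof (intro allI impI)
  fix \<epsilon> :: real assume "\<epsilon> > 0"
  then obtain t' where t': "t' \<in> fsingle x" "Gm x y - \<epsilon> < t'" "t' < Gm x y" by (rule fsingle_left)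
  show "\<exists>t'\<in>fsingle x. t' \<noteq> Gm x y \<and> dist t' (Gm x y) < \<epsilon>"
    by (rule bexI[OF _ t'(1)]) (use t' in \<open>auto simp: dist_real_def\<close>)
qed

lemma fsingle_islimpt: "t \<in> fsingle x \<Longrightarrow> t islimpt fsingle x"
proof -
  assume "t \<in> fsingle x"
  then have "Gp x (\<phi> x t) = t" using phi_Gp unfolding fsingle_def by blast
  then show ?thesis using fsingle_islimpt_Gp by metis
qed

lemma fsingle_nonempty: "fsingle x \<noteq> {}"
  using regular_between[of 0 1 x] by (metis empty_iff zero_less_one)

text \<open>The ends of the \<phi>-fibre of \<open>t\<close> are limits of singleton fibres, so
  \<open>t\<close> lies strictly inside it. A nondegenerate fibre sits at some n\<beta> + m, and
  subtracting \<open>m\<close> moves it to the standard copy.\<close>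

lemma not_closure_fsingle:
  assumes "t \<notin> closure (fsingle x)"
  obtains n m :: int where "t - of_int m \<in> gap n x"
proof -
  define y where "y = \<phi> x t"
  have "Gp x y \<in> closure (fsingle x)" "Gm x y \<in> closure (fsingle x)"
    using fsingle_islimpt_Gp fsingle_islimpt_Gm by (auto simp: closure_def)
  then have "t \<noteq> Gp x y" "t \<noteq> Gm x y" using assms by auto
  then have t: "Gm x y < t" "t < Gp x y" using phi_le[of x t] phi_ge[of t x] by (auto simp: y_def)
  then obtain n where n: "y - of_int n * \<beta> \<in> \<int>" using no_jump[of y x] by fastforce
  then obtain m :: int where "y - of_int n * \<beta> = of_int m" by (auto elim: Ints_cases)
  then have y: "y = of_int n * \<beta> + of_int m" by simp
  have "Gp x y = Gp x (of_int n * \<beta>) + of_int m" "Gm x y = Gm x (of_int n * \<beta>) + of_int m"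
    unfolding y using add_int_of_add_one[of "Gp x" 1 1 "of_int n * \<beta>" m] add_int_of_add_one[of "Gm x" 1 1 "of_int n * \<beta>" m]
    by (simp_all add: Gp_plus1 Gm_plus1)
  then show ?thesis using t by (intro that[of m n]) (auto simp: gap_eq)
qed

text \<open>The value of \<phi> on a gap is n\<beta>, which modulo 1 determines the index. Hence
  projected regions with different indices are disjoint.\<close>

lemma gap_translates_disjoint:
  assumes "t \<in> gap n x" "t' \<in> gap k x'" "\<phi> x t - \<phi> x' t' \<in> \<int>"
  shows "n = k"
proof -
  have "of_int n * \<beta> - of_int k * \<beta> \<in> \<int>" using assms phi_gap by metis
  then show ?thesis using orbit_unique[of "of_int n * \<beta>" n k] by simp
qed

lemma phi_int: "\<phi> (x + of_int i) (t + of_int j) = \<phi> x t + of_int j"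
proof -
  have "\<phi> (x + of_int i) s = \<phi> x s" for s
    using add_int_of_add_one[of "\<lambda>x. \<phi> x s" 1 0 x i] by (simp add: phi_plus1)
  then show ?thesis using add_int_of_add_one[of "\<phi> x" 1 1 t j] by (simp add: phi_plus1)
qed

lemma phi_proj: "proj (x, t) = proj (x', t') \<Longrightarrow> \<phi> x t - \<phi> x' t' \<in> \<int>"
proof -
  assume "proj (x, t) = proj (x', t')"
  then obtain i j :: int where "x = x' + of_int i" "t = t' + of_int j" unfolding proj_eq_iff_translate by auto
  then show ?thesis using phi_int[of x' i t' j] by simp
qed

lemma wt_le: "wt n \<le> 1/4"
  using power_le_one[of "1/2::real" "to_nat n"] by (simp add: wt_def)

lemma gap_width: "t \<in> gap n x \<Longrightarrow> t' \<in> gap n x \<Longrightarrow> \<bar>t - t'\<bar> < 1/4"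
proof -
  assume "t \<in> gap n x" "t' \<in> gap n x"
  moreover have "wt n * T n x \<le> 1/4 * 1" using wt_le[of n] T_range[of n x] wt_pos[of n] by (intro mult_mono) auto
  ultimately show ?thesis unfolding gap_def abs_less_iff greaterThanLessThan_iff by linarith
qed

lemma f_fibred: "fibred (\<lambda>x. x + \<alpha>) f"
  unfolding fibred_def
proof (intro conjI allI)
  show "strict_mono (f x)" for x using f_strict_mono by (rule strict_monoI)
qed (auto simp: f_continuous f_plus1 strict_mono_def intro!: continuous_intros)

end

subsection \<open>Type I\<close>

lemma homeomorphic_injective_open_map:
  assumes "continuous_on S f" "inj_on f S" "\<And>U. openin (top_of_set S) U \<Longrightarrow> openin (top_of_set (f ` S)) (f ` U)"
  shows "S homeomorphic f ` S"
proof -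
  obtain g where "homeomorphism S (f ` S) f g"
    by (rule homeomorphism_injective_open_map[OF assms(1) refl assms(2,3)])
  then show ?thesis by (auto simp: homeomorphic_def)
qed

lemma homeomorphic_proj_image:
  assumes "open W" "inj_on proj W"
  shows "W homeomorphic proj ` W"
proof (rule homeomorphic_injective_open_map[OF continuous_on_proj[OF continuous_on_id] assms(2)])
  fix U assume "openin (top_of_set W) U"
  then have U: "open U" "U \<subseteq> W" using assms(1) openin_open_eq by auto
  then show "openin (top_of_set (proj ` W)) (proj ` U)"
    by (intro openin_subset_trans[OF proj_open_map] image_mono) auto
qed

lemma homeomorphic_circ_image:
  assumes "d \<le> c + 1"
  shows "{c<..<d} homeomorphic circ ` {c<..<d}"
proof (rule homeomorphic_injective_open_map[OF continuous_on_circ[OF continuous_on_id]])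
  show "inj_on circ {c<..<d}"
  proof (rule inj_onI)
    fix s t assume st: "s \<in> {c<..<d}" "t \<in> {c<..<d}" "circ s = circ t"
    then obtain m :: int where m: "s - t = of_int m" by (auto simp: circ_eq_iff elim: Ints_cases)
    have "\<bar>s - t\<bar> < 1" using st assms by auto
    then have "m = 0" using m by linarith
    then show "s = t" using m by simp
  qed
  fix U assume "openin (top_of_set {c<..<d}) U"
  then have U: "open U" "U \<subseteq> {c<..<d}" using openin_open_eq[of "{c<..<d}"] by auto
  then show "openin (top_of_set (circ ` {c<..<d})) (circ ` U)"
    by (intro openin_subset_trans[OF circ_open_map] image_mono) auto
qed

lemma box_homeomorphic_ball: "{-1/4<..<1/4::real} \<times> {0<..<1::real} homeomorphic ball (0::complex) 1"
proof -
  have "{-1/4<..<1/4::real} \<times> {0<..<1::real} = box (-1/4::real, 0::real) (1/4, 1)"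
    by (auto simp: box_def Basis_prod_def)
  moreover have "box (-1/4::real, 0::real) (1/4, 1::real) homeomorphic (UNIV :: (real \<times> real) set)"
    by (rule homeomorphic_box_UNIV) (simp add: box_ne_empty Basis_prod_def)
  ultimately have "{-1/4<..<1/4::real} \<times> {0<..<1::real} homeomorphic (UNIV :: (real \<times> real) set)" by simp
  also have "(UNIV :: (real \<times> real) set) homeomorphic (UNIV :: complex set)"
    unfolding homeomorphic_UNIV_UNIV by simp
  also have "(UNIV :: complex set) homeomorphic ball (0::complex) 1"
    using homeomorphic_ball01_UNIV homeomorphic_sym by blast
  finally (homeomorphic_trans) show ?thesis .
qed

section \<open>Lens-shaped gaps produced by a bump\<close>

locale disk_blowup = blowup +
  assumes indep: "rat_indep \<alpha> \<beta>"
    and tau_pos: "\<bar>x\<bar> < 1/4 \<Longrightarrow> \<tau> x > 0"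
    and tau_zero: "1/4 \<le> x \<Longrightarrow> x \<le> 3/4 \<Longrightarrow> \<tau> x = 0"
begin

sublocale torus_semiconj "\<lambda>x. x + \<alpha>" f "\<lambda>z. (fst z, \<phi> (fst z) (snd z))" \<alpha> \<beta> "1/2"
proof
  show "norm ((fst z, \<phi> (fst z) (snd z)) - z) \<le> 1/2" for z
    using phi_bounds(1)[of "snd z" "fst z"] phi_bounds(2)[of "fst z" "snd z"] by (cases z) (simp add: norm_Pair)
  show "(fst (fibmap (\<lambda>x. x + \<alpha>) f z), \<phi> (fst (fibmap (\<lambda>x. x + \<alpha>) f z)) (snd (fibmap (\<lambda>x. x + \<alpha>) f z))) =
      (fst z, \<phi> (fst z) (snd z)) + (\<alpha>, \<beta>)" for z
    by (simp add: fibmap_def phi_f)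
qed (auto intro!: f_fibred indep continuous_intros phi_continuous simp: equivariant_def phi_plus1)

lemma singles_eq: "(x, t) \<in> singles \<longleftrightarrow> t \<in> fsingle x"
  by (auto simp: singles_def fsingle_def)

text \<open>The semiconjugacy collapses this set onto an open horizontal segment of length 1/2
  centred at (n\<alpha>, n\<beta>); the other lifts are its integer translates.\<close>

definition lens :: "int \<Rightarrow> (real \<times> real) set" where
  "lens n = {z. \<bar>fst z - of_int n * \<alpha>\<bar> < 1/4 \<and> snd z \<in> gap n (fst z)}"

lemma open_lens: "open (lens n)"
proof -
  have [continuous_intros]: "continuous_on UNIV (\<lambda>z. Gp (fst z) c)" "continuous_on UNIV (\<lambda>z. T n (fst z))"
    for c and z :: "real \<times> real"
    by (rule continuous_on_compose2[OF Gp_continuous continuous_on_fst[OF continuous_on_id]]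
        continuous_on_compose2[OF T_continuous continuous_on_fst[OF continuous_on_id]], simp)+
  show ?thesis
    unfolding lens_def gap_def greaterThanLessThan_iff
    by (intro open_Collect_conj open_Collect_less continuous_intros)
qed

lemma lens_singles: "lens n \<inter> singles = {}"
proof -
  have "z \<notin> singles" if "z \<in> lens n" for z
    using that gap_not_fsingle[of n "fst z"] singles_eq[of "fst z" "snd z"] by (auto simp: lens_def)
  then show ?thesis by blast
qed

lemma T_pos: "\<bar>x - of_int n * \<alpha>\<bar> < 1/4 \<Longrightarrow> T n x > 0"
  unfolding T_def by (rule tau_pos)

lemma T_pos_translate:
  assumes "T n x > 0"
  obtains i :: int where "\<bar>x - of_int i - of_int n * \<alpha>\<bar> < 1/4"
proof -
  define u where "u = x - of_int n * \<alpha>"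
  \<comment> \<open>This puts \<open>u - i\<close> into the period from -1/4 to 3/4, where the sign
    of \<tau> is known; the left end is excluded because \<tau> has the same value there as at
    3/4.\<close>
  define i where "i = \<lfloor>u + 1/4\<rfloor>"
  have i: "-1/4 \<le> u - of_int i" "u - of_int i < 3/4" unfolding i_def by linarith+
  have tau: "\<tau> (u - of_int i) > 0"
    using add_int_of_add_one[of \<tau> 1 0 u "-i"] tau_periodic assms by (simp add: T_def u_def)
  have "\<tau> (-1/4) = 0" using tau_periodic[of "-1/4"] tau_zero[of "3/4"] by simp
  then have "u - of_int i \<noteq> -1/4" using tau by auto
  moreover have "\<not> 1/4 \<le> u - of_int i" using tau tau_zero[of "u - of_int i"] i by auto
  ultimately have "\<bar>u - of_int i\<bar> < 1/4" using i by linarith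
  then show ?thesis by (intro that[of i]) (simp add: u_def algebra_simps)
qed

text \<open>Closure within a fibre is contained in the planar closure, so the fibrewise description
  of the gaps applies. A nonempty gap forces \<open>T n x > 0\<close>, which places \<open>x\<close>
  over the base of a lens modulo the integers.\<close>

lemma proj_lens_cover:
  assumes "z \<notin> closure singles"
  shows "proj z \<in> (\<Union>n. proj ` lens n)"
proof -
  obtain x t where z: "z = (x, t)" by (cases z)
  have "t \<notin> closure (fsingle x)"
  proof
    assume "t \<in> closure (fsingle x)"
    moreover have "(\<lambda>t. (x, t)) ` closure (fsingle x) \<subseteq> closure singles"
    proof (rule image_closure_subset[OF _ closed_closure])
      show "continuous_on (closure (fsingle x)) (\<lambda>t. (x, t))" by (intro continuous_intros)
      have "(\<lambda>t. (x, t)) ` fsingle x \<subseteq> singles" by (auto simp: singles_eq)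
      then show "(\<lambda>t. (x, t)) ` fsingle x \<subseteq> closure singles" using closure_subset by blast
    qed
    ultimately show False using assms z by blast
  qed
  then obtain n m :: int where nm: "t - of_int m \<in> gap n x" by (rule not_closure_fsingle)
  then have "0 < wt n * T n x" by (auto simp: gap_def)
  then have "T n x > 0" using wt_pos[of n] by (simp add: zero_less_mult_iff)
  then obtain i :: int where i: "\<bar>x - of_int i - of_int n * \<alpha>\<bar> < 1/4" by (rule T_pos_translate)
  have "gap n (x - of_int i) = gap n x"
    unfolding gap_def
    using add_int_of_add_one[of "\<lambda>x. Gp x (of_int n * \<beta>)" 1 0 x "-i"] add_int_of_add_one[of "T n" 1 0 x "-i"]
    by (simp add: Gp_plus1)
  then have "(x - of_int i, t - of_int m) \<in> lens n" using nm i by (simp add: lens_def)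
  moreover have "proj z = proj (x - of_int i, t - of_int m)" by (simp add: proj_eq_iff z)
  ultimately show ?thesis by blast
qed

lemma complement: "T2 - Mset = (\<Union>n. proj ` lens n)"
  by (rule complement_Mset[OF open_lens lens_singles proj_lens_cover])

text \<open>A base of length 1/2 and vertical differences below 1/4 leave no room for a nonzero
  integer translation.\<close>

lemma inj_on_proj_lens: "inj_on proj (lens n)"
proof (rule inj_onI)
  fix z w assume zw: "z \<in> lens n" "w \<in> lens n" "proj z = proj w"
  obtain i j :: int where ij: "z = w + (of_int i, of_int j)" using zw(3) unfolding proj_eq_iff_translate by blast
  have "\<bar>fst z - of_int n * \<alpha>\<bar> < 1/4" "\<bar>fst w - of_int n * \<alpha>\<bar> < 1/4" "fst z = fst w + of_int i"
    using zw ij unfolding lens_def by auto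
  then have "\<bar>real_of_int i\<bar> < 1" by linarith
  then have i: "i = 0" by linarith
  then have "\<bar>snd z - snd w\<bar> < 1/4" using zw ij by (intro gap_width[of _ n "fst w"]) (auto simp: lens_def)
  then have "\<bar>real_of_int j\<bar> < 1" using ij by simp
  then have "j = 0" by linarith
  then show "z = w" using ij i by (simp add: prod_eq_iff)
qed

text \<open>Every vertical segment is rescaled to unit length; its length
  \<open>wt n * T n x\<close> is continuous and positive over the open base.\<close>

lemma lens_homeomorphic_box: "{-1/4<..<1/4::real} \<times> {0<..<1::real} homeomorphic lens n"
proof -
  define c where "c = of_int n * \<alpha>"
  define g where "g z = (fst z + c, Gp (fst z + c) (of_int n * \<beta>) - snd z * (wt n * T n (fst z + c)))" for z :: "real \<times> real"
  define h where "h w = (fst w - c, (Gp (fst w) (of_int n * \<beta>) - snd w) / (wt n * T n (fst w)))" for w :: "real \<times> real"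
  have pos: "wt n * T n x > 0" if "\<bar>x - c\<bar> < 1/4" for x
    using T_pos that wt_pos by (simp add: c_def)
  have contGp: "continuous_on S (\<lambda>z. Gp (k z) y)" if "continuous_on S k" for S and k :: "real \<times> real \<Rightarrow> real" and y
    by (rule continuous_on_compose2[OF Gp_continuous that]) simp
  have contT: "continuous_on S (\<lambda>z. T n (k z))" if "continuous_on S k" for S and k :: "real \<times> real \<Rightarrow> real"
    by (rule continuous_on_compose2[OF T_continuous that]) simp
  have "homeomorphism ({-1/4<..<1/4::real} \<times> {0<..<1::real}) (lens n) g h"
  proof (rule homeomorphismI)
    show "continuous_on ({-1/4<..<1/4} \<times> {0<..<1}) g"
      unfolding g_def by (intro continuous_intros contGp contT)
    show "continuous_on (lens n) h"
      unfolding h_def using pos by (intro continuous_intros contGp contT) (force simp: lens_def c_def)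
    show "g ` ({-1/4<..<1/4} \<times> {0<..<1}) \<subseteq> lens n"
    proof (rule image_subsetI)
      fix z :: "real \<times> real" assume z: "z \<in> {-1/4<..<1/4} \<times> {0<..<1}"
      then have a: "\<bar>fst z\<bar> < 1/4" by auto
      have p: "wt n * T n (fst z + c) > 0" by (rule pos) (use a in simp)
      have "0 < snd z" "snd z < 1" using z by auto
      then have "0 < snd z * (wt n * T n (fst z + c))" "snd z * (wt n * T n (fst z + c)) < 1 * (wt n * T n (fst z + c))"
        using p by (simp, intro mult_strict_right_mono)
      then show "g z \<in> lens n" using a by (simp add: g_def lens_def gap_def c_def)
    qed
    show "h ` lens n \<subseteq> {-1/4<..<1/4} \<times> {0<..<1}"
    proof (rule image_subsetI)
      fix w assume w: "w \<in> lens n"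
      have p: "wt n * T n (fst w) > 0" by (rule pos) (use w in \<open>simp add: lens_def c_def\<close>)
      show "h w \<in> {-1/4<..<1/4} \<times> {0<..<1}"
      proof -
        have "\<bar>fst w - c\<bar> < 1/4" using w by (simp add: lens_def c_def)
        then have "-1/4 < fst w - c" "fst w - c < 1/4" by linarith+
        moreover have "0 < Gp (fst w) (of_int n * \<beta>) - snd w" "Gp (fst w) (of_int n * \<beta>) - snd w < wt n * T n (fst w)"
          using w by (auto simp: lens_def gap_def)
        then have "0 < (Gp (fst w) (of_int n * \<beta>) - snd w) / (wt n * T n (fst w))"
          "(Gp (fst w) (of_int n * \<beta>) - snd w) / (wt n * T n (fst w)) < 1"
          using p by (simp_all only: divide_pos_pos divide_less_eq_1_pos)
        ultimately show ?thesis by (simp add: h_def)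
      qed
    qed
    show "h (g z) = z" if "z \<in> {-1/4<..<1/4} \<times> {0<..<1}" for z
    proof -
      have "wt n * T n (fst z + c) > 0" by (rule pos) (use that in auto)
      then have "wt n \<noteq> 0" "T n (fst z + c) \<noteq> 0" by auto
      then show ?thesis by (simp add: g_def h_def)
    qed
    show "g (h w) = w" if "w \<in> lens n" for w
    proof -
      have "wt n * T n (fst w) > 0" by (rule pos) (use that in \<open>simp add: lens_def c_def\<close>)
      then have "wt n \<noteq> 0" "T n (fst w) \<noteq> 0" by auto
      then show ?thesis by (simp add: g_def h_def)
    qed
  qed
  then show ?thesis by (auto simp: homeomorphic_def)
qed

lemma is_disk_lens: "is_disk (proj ` lens n)"
proof -
  have "ball (0::complex) 1 homeomorphic lens n"
    using homeomorphic_trans[OF homeomorphic_sym[THEN iffD1, OF box_homeomorphic_ball] lens_homeomorphic_box] .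
  then have "ball (0::complex) 1 homeomorphic proj ` lens n"
    using homeomorphic_trans homeomorphic_proj_image[OF open_lens inj_on_proj_lens] by blast
  then show ?thesis by (auto simp: is_disk_def)
qed

lemma connected_is_disk: "is_disk U \<Longrightarrow> connected U"
  unfolding is_disk_def using homeomorphic_connectedness connected_ball by blast

lemma lens_disjoint: "n \<noteq> k \<Longrightarrow> proj ` lens n \<inter> proj ` lens k = {}"
proof -
  assume "n \<noteq> k"
  have "proj z \<noteq> proj w" if "z \<in> lens n" "w \<in> lens k" for z w
  proof
    assume "proj z = proj w"
    then have "\<phi> (fst z) (snd z) - \<phi> (fst w) (snd w) \<in> \<int>" using phi_proj[of "fst z" "snd z"] by simp
    then show False using gap_translates_disjoint[of "snd z" n "fst z" "snd w" k "fst w"] that \<open>n \<noteq> k\<close>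
      by (simp add: lens_def)
  qed
  then have "p \<notin> proj ` lens k" if "p \<in> proj ` lens n" for p
    using that by (elim imageE) auto
  then show ?thesis by blast
qed

lemma disk_complement: "U \<in> components (T2 - Mset) \<Longrightarrow> is_disk U"
proof -
  assume "U \<in> components (T2 - Mset)"
  then have "U \<in> components (\<Union>n. proj ` lens n)" by (simp add: complement)
  from components_Union_disjoint_open(1)[OF proj_open_map[OF open_lens] connected_is_disk[OF is_disk_lens] lens_disjoint this]
  obtain n where "U = proj ` lens n" by blast
  then show ?thesis using is_disk_lens by simp
qed

lemma Mset_not_T2: "Mset \<noteq> T2"
proof -
  have "lens 0 \<noteq> {}" using lens_homeomorphic_box[of 0] homeomorphic_empty by force
  then show ?thesis using complement by blast
qed

lemma singles_nonempty: "singles \<noteq> {}"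
  using fsingle_nonempty[of 0] singles_eq[of 0] by blast

end

theorem type_I:
  assumes "rat_indep \<alpha> \<beta>"
  shows "\<exists>f M. homeo_star f \<and> minimal_set f M \<and> M \<noteq> T2 \<and> (\<forall>U \<in> components (T2 - M). is_disk U)"
proof -
  have lip: "\<bar>cos u - cos u'\<bar> \<le> \<bar>u - u'\<bar>" for u u' :: real
  proof -
    have "dist (cos u) (cos u') \<le> 1 * dist u u'"
      by (rule differentiable_bound[of UNIV cos "\<lambda>x h. - sin x * h" 1 u u', unfolded real_norm_def[symmetric] dist_norm[symmetric]])
         (auto intro!: derivative_eq_intros onorm_le simp: has_field_derivative_def abs_mult mult_left_le_one_le)
    then show ?thesis by (simp add: dist_real_def)
  qed
  \<comment> \<open>The positive part of the cosine has the required signs on a period, and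
    \<open>2 * pi\<close> bounds the derivative of the cosine before truncation.\<close>
  interpret disk_blowup \<alpha> \<beta> "\<lambda>x. max 0 (cos (2 * pi * x))" "2 * pi"
  proof
    show "n = 0" if "of_int n * \<beta> = of_int m" for n m :: int
      using assms that unfolding rat_indep_def by (metis add.right_neutral add_neg_numeral_special(7) add.commute mult_zero_left of_int_0 of_int_minus add.left_inverse)
    show "max 0 (cos (2 * pi * (x + 1))) = max 0 (cos (2 * pi * x))" for x
      by (simp add: distrib_left)
    show "\<bar>max 0 (cos (2 * pi * x)) - max 0 (cos (2 * pi * x'))\<bar> \<le> 2 * pi * \<bar>x - x'\<bar>" for x x'
    proof -
      have "\<bar>max 0 (cos (2 * pi * x)) - max 0 (cos (2 * pi * x'))\<bar> \<le> \<bar>cos (2 * pi * x) - cos (2 * pi * x')\<bar>" by linarith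
      also have "\<dots> \<le> \<bar>2 * pi * x - 2 * pi * x'\<bar>" by (rule lip)
      finally show ?thesis by (simp add: abs_mult flip: right_diff_distrib)
    qed
    show "0 < max 0 (cos (2 * pi * x))" if "\<bar>x\<bar> < 1/4" for x
    proof -
      have "pi * x < pi * (1/4)" "pi * (- 1/4) < pi * x" using that by (intro mult_strict_left_mono; simp add: abs_less_iff)+
      then have "cos (2 * pi * x) > 0" by (intro cos_gt_zero_pi) auto
      then show ?thesis by simp
    qed
    show "max 0 (cos (2 * pi * x)) = 0" if "1/4 \<le> x" "x \<le> 3/4" for x
    proof -
      have "pi * (1/4) \<le> pi * x" "pi * x \<le> pi * (3/4)" using that by (intro mult_left_mono; simp)+
      then have "0 \<le> cos (2 * pi * x - pi)" by (intro cos_ge_zero; linarith)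
      then show ?thesis by simp
    qed
  qed (use assms in auto)
  show ?thesis
    using homeo_star_F minimal_set_Mset[OF singles_nonempty] Mset_not_T2 disk_complement by blast
qed

subsection \<open>Type II\<close>

lemma homotopic_paths_Pair:
  assumes "homotopic_paths S p p'" "homotopic_paths T q q'"
  shows "homotopic_paths (S \<times> T) (\<lambda>x. (p x, q x)) (\<lambda>x. (p' x, q' x))"
proof -
  obtain h where h: "continuous_on ({0..1} \<times> {0..1}) h" "h \<in> ({0..1} \<times> {0..1}) \<rightarrow> S"
    "\<forall>x\<in>{0..1}. h (0, x) = p x" "\<forall>x\<in>{0..1}. h (1, x) = p' x"
    "\<forall>t\<in>{0..1::real}. pathstart (h \<circ> Pair t) = pathstart p \<and> pathfinish (h \<circ> Pair t) = pathfinish p"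
    using assms(1) unfolding homotopic_paths by blast
  obtain k where k: "continuous_on ({0..1} \<times> {0..1}) k" "k \<in> ({0..1} \<times> {0..1}) \<rightarrow> T"
    "\<forall>x\<in>{0..1}. k (0, x) = q x" "\<forall>x\<in>{0..1}. k (1, x) = q' x"
    "\<forall>t\<in>{0..1::real}. pathstart (k \<circ> Pair t) = pathstart q \<and> pathfinish (k \<circ> Pair t) = pathfinish q"
    using assms(2) unfolding homotopic_paths by blast
  show ?thesis
    unfolding homotopic_paths
  proof (rule exI[of _ "\<lambda>z. (h z, k z)"], intro conjI)
    show "continuous_on ({0..1} \<times> {0..1}) (\<lambda>z. (h z, k z))" by (intro continuous_on_Pair h k)
    show "(\<lambda>z. (h z, k z)) \<in> ({0..1} \<times> {0..1}) \<rightarrow> S \<times> T" using h(2) k(2) by (simp add: Pi_iff)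
  qed (use h(3-5) k(3-5) in \<open>simp_all add: pathstart_def pathfinish_def\<close>)
qed

text \<open>A contraction of the loop in \<open>X \<times> Y\<close> is projected to
  \<open>X\<close> and paired with a contraction of the second coordinate inside the simply
  connected \<open>A\<close>.\<close>

lemma pi1_injective_slab:
  fixes X :: "'a::real_normed_vector set" and A Y :: "'b::real_normed_vector set"
  assumes "simply_connected A"
  shows "pi1_injective (X \<times> A) (X \<times> Y)"
  unfolding pi1_injective_def
proof (intro allI impI)
  fix \<gamma> :: "real \<Rightarrow> 'a \<times> 'b"
  assume as: "path \<gamma> \<and> path_image \<gamma> \<subseteq> X \<times> A \<and> pathfinish \<gamma> = pathstart \<gamma> \<and>
      homotopic_paths (X \<times> Y) \<gamma> (linepath (pathstart \<gamma>) (pathstart \<gamma>))"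
  have 1: "homotopic_paths X (fst \<circ> \<gamma>) (fst \<circ> linepath (pathstart \<gamma>) (pathstart \<gamma>))"
    by (rule homotopic_paths_continuous_image[where S = "X \<times> Y"]) (use as in \<open>auto intro!: continuous_intros\<close>)
  have 2: "homotopic_paths A (snd \<circ> \<gamma>) (linepath (pathstart (snd \<circ> \<gamma>)) (pathstart (snd \<circ> \<gamma>)))"
  proof -
    have "path (snd \<circ> \<gamma>)" using as by (auto simp: path_def o_def intro!: continuous_intros)
    moreover have "path_image (snd \<circ> \<gamma>) \<subseteq> A" using as by (force simp: path_image_def)
    moreover have "pathfinish (snd \<circ> \<gamma>) = pathstart (snd \<circ> \<gamma>)" using as by (simp add: pathstart_def pathfinish_def)
    ultimately show ?thesis using assms unfolding simply_connected_eq_contractible_path by blast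
  qed
  have "linepath (pathstart \<gamma>) (pathstart \<gamma>) =
      (\<lambda>x. ((fst \<circ> linepath (pathstart \<gamma>) (pathstart \<gamma>)) x, linepath (pathstart (snd \<circ> \<gamma>)) (pathstart (snd \<circ> \<gamma>)) x))"
    by (simp add: linepath_refl pathstart_def)
  then show "homotopic_paths (X \<times> A) \<gamma> (linepath (pathstart \<gamma>) (pathstart \<gamma>))"
    using homotopic_paths_Pair[OF 1 2] by (simp add: o_def)
qed

section \<open>Denjoy homeomorphisms of the circle\<close>

locale circle_blowup = blowup 0 \<beta> "\<lambda>_. 1" 0 for \<beta>
begin

text \<open>Base rotation 0 maps the fibre over 0 to itself; \<open>D\<close> is the lift of a
  Denjoy homeomorphism and \<open>h\<close> its semiconjugacy to the translation by \<beta>.\<close>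

definition D :: "real \<Rightarrow> real" where "D = f 0"
definition h :: "real \<Rightarrow> real" where "h = \<phi> 0"

lemma h_D: "h (D t) = h t + \<beta>"
  using phi_f[of 0 t] by (simp add: h_def D_def)

lemma D_plus1: "D (t + 1) = D t + 1" and h_plus1: "h (t + 1) = h t + 1"
  by (simp_all add: D_def h_def f_plus1 phi_plus1)

lemma strict_mono_D: "strict_mono D"
  unfolding D_def using f_strict_mono by (rule strict_monoI)

lemma continuous_on_D: "continuous_on S D"
  using continuous_on_compose2[OF f_continuous, of S "\<lambda>t. (0, t)"]
  by (simp add: D_def continuous_on_Pair continuous_on_id continuous_on_const)

lemma continuous_on_h: "continuous_on S h"
  using continuous_on_compose2[OF phi_continuous, of S "\<lambda>t. (0, t)"]
  by (simp add: h_def continuous_on_Pair continuous_on_id continuous_on_const)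

lemma h_near_id: "\<bar>h t - t\<bar> \<le> 1/2"
  using phi_bounds(1)[of t 0] phi_bounds(2)[of 0 t] by (simp add: h_def)

definition sing :: "real set" where "sing = fsingle 0"

lemma mem_sing: "t \<in> sing \<longleftrightarrow> (\<forall>t'. h t' = h t \<longrightarrow> t' = t)"
  by (simp add: sing_def fsingle_def h_def)

definition gap0 :: "int \<Rightarrow> real set" where "gap0 n = gap n 0"

lemma gap0_interval: "gap0 n = {Gp 0 (of_int n * \<beta>) - wt n <..< Gp 0 (of_int n * \<beta>)}"
  by (simp add: gap0_def gap_def T_def)

lemma open_gap0: "open (gap0 n)"
  by (simp add: gap0_interval)

lemma gap0_nonempty: "gap0 n \<noteq> {}"
  using wt_pos[of n] by (simp add: gap0_interval)

lemma gap0_sing: "gap0 n \<inter> sing = {}"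
  unfolding gap0_def sing_def by (rule gap_not_fsingle)

lemma not_closure_sing:
  assumes "t \<notin> closure sing"
  obtains n m :: int where "t - of_int m \<in> gap0 n"
  using not_closure_fsingle[of t 0] assms unfolding gap0_def sing_def by blast

lemma gap0_disjoint: "t \<in> gap0 n \<Longrightarrow> t' \<in> gap0 k \<Longrightarrow> t - t' \<in> \<int> \<Longrightarrow> n = k"
proof -
  assume t: "t \<in> gap0 n" "t' \<in> gap0 k" "t - t' \<in> \<int>"
  then have "proj (0, t) = proj (0, t')" by (simp add: proj_eq_iff)
  from phi_proj[OF this] show "n = k" using t(1,2) gap_translates_disjoint unfolding gap0_def by blast
qed

lemma sing_nonempty: "sing \<noteq> {}"
  unfolding sing_def by (rule fsingle_nonempty)

lemma sing_islimpt: "t \<in> sing \<Longrightarrow> t islimpt sing"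
  unfolding sing_def by (rule fsingle_islimpt)

lemma beta_irrational: "\<beta> \<notin> \<rat>"
proof
  assume "\<beta> \<in> \<rat>"
  then obtain m n :: int where "n > 0" "\<beta> = of_int m / of_int n"
    by (elim Rats_cases') auto
  then show False using irr[of n m] by (simp add: field_simps)
qed

text \<open>If \<open>h\<close> is constant between \<open>c\<close> and \<open>d\<close>, no point
  there has a singleton fibre. Otherwise density of n\<beta> modulo 1 puts an orbit point strictly
  between the values of \<open>h\<close> at the ends, and its whole gap fits in between. Either way
  the closure of \<open>sing\<close> does not fill the interval.\<close>

lemma gap0_dense:
  assumes "c < d"
  obtains t n and m :: int where "c < t" "t < d" "t - of_int m \<in> gap0 n"
proof -
  have cl: "\<not> {c<..<d} \<subseteq> closure sing"
  proof
    assume sub: "{c<..<d} \<subseteq> closure sing"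
    show False
    proof (cases "h c = h d")
      case True
      have same: "h s = h c" if "s \<in> {c<..<d}" for s
        using phi_mono[of c s 0] phi_mono[of s d 0] that True by (simp add: h_def)
      have "s \<notin> sing" if "s \<in> {c<..<d}" for s
        using same[OF that] that unfolding mem_sing by (metis greaterThanLessThan_iff less_irrefl)
      then have "{c<..<d} \<inter> closure sing = {}" using open_Int_closure_eq_empty[of "{c<..<d}" sing] by auto
      moreover have "{c<..<d} \<noteq> {}" using assms by simp
      ultimately show False using sub by blast
    next
      case False
      then have less: "h c < h d" using phi_mono[of c d 0] assms by (simp add: h_def)
      obtain n m :: int where nm: "\<bar>of_int n * \<beta> - of_int m - (h c + h d) / 2\<bar> < (h d - h c) / 2"
        using sequence_of_fractional_parts_is_dense[OF beta_irrational, of "(h d - h c) / 2" "(h c + h d) / 2"] less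
        by (metis diff_gt_0_iff_gt half_gt_zero)
      define y where "y = of_int n * \<beta> - of_int m"
      have y: "h c < y" "y < h d" using nm unfolding y_def abs_less_iff by (simp_all add: field_simps)
      have jump: "Gp 0 y - Gm 0 y = wt n"
        using jump_at_orbit[of y n 0] by (simp add: y_def T_def)
      have "c \<le> Gp 0 (h c)" "Gm 0 (h d) \<le> d" using phi_ge phi_le by (auto simp: h_def)
      then have cd: "c < Gm 0 y" "Gp 0 y < d" using Gp_less_Gm_strict[OF y(1), of 0] Gp_less_Gm_strict[OF y(2), of 0] by auto
      have hy: "h s = y" if "s \<in> {Gm 0 y<..<Gp 0 y}" for s
        unfolding h_def by (rule phi_eqI) (use that in auto)
      have "s \<notin> sing" if s: "s \<in> {Gm 0 y<..<Gp 0 y}" for s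
      proof
        assume "s \<in> sing"
        moreover have "h (Gp 0 y) = h s" using hy[OF s] phi_Gp by (simp add: h_def)
        ultimately have "Gp 0 y = s" unfolding mem_sing by blast
        then show False using s by simp
      qed
      then have "{Gm 0 y<..<Gp 0 y} \<inter> closure sing = {}" using open_Int_closure_eq_empty[of "{Gm 0 y<..<Gp 0 y}" sing] by auto
      moreover have "{Gm 0 y<..<Gp 0 y} \<noteq> {}" using jump wt_pos[of n] by auto
      moreover have "{Gm 0 y<..<Gp 0 y} \<subseteq> {c<..<d}" using cd by auto
      ultimately show False using sub by blast
    qed
  qed
  then obtain t where t: "t \<in> {c<..<d}" "t \<notin> closure sing" by blast
  obtain n m :: int where "t - of_int m \<in> gap0 n" by (rule not_closure_sing[OF t(2)])
  then show ?thesis using t(1) by (intro that[of t m n]) auto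
qed

end

section \<open>The product of a rotation with a Denjoy homeomorphism\<close>

locale annulus_blowup = circle_blowup +
  fixes \<alpha>
  assumes indep: "rat_indep \<alpha> \<beta>"
begin

sublocale torus_semiconj "\<lambda>x. x + \<alpha>" "\<lambda>_. D" "\<lambda>z. (fst z, h (snd z))" \<alpha> \<beta> "1/2"
proof
  show "fibred (\<lambda>x. x + \<alpha>) (\<lambda>_. D)"
    unfolding fibred_def
    by (auto simp: strict_mono_def D_plus1 strict_mono_D strict_monoD[OF strict_mono_D]
        intro!: continuous_intros continuous_on_compose2[OF continuous_on_D])
  show "continuous_on UNIV (\<lambda>z. (fst z, h (snd z)))"
    by (auto intro!: continuous_intros continuous_on_compose2[OF continuous_on_h])
  show "norm ((fst z, h (snd z)) - z) \<le> 1/2" for z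
    using h_near_id[of "snd z"] by (cases z) (simp add: norm_Pair)
qed (auto simp: equivariant_def h_plus1 fibmap_def h_D indep)

lemma singles_eq: "singles = UNIV \<times> sing"
  by (auto simp: singles_def mem_sing)

abbreviation "slab n \<equiv> UNIV \<times> gap0 n"

lemma proj_slab: "proj ` slab n = sphere 0 1 \<times> circ ` gap0 n"
proof -
  have "proj ` slab n = range circ \<times> circ ` gap0 n" by (force simp: proj_eq image_iff)
  then show ?thesis by (simp add: range_circ)
qed

lemma complement: "T2 - Mset = (\<Union>n. proj ` slab n)"
proof (rule complement_Mset)
  show "open (slab n)" for n by (intro open_Times open_UNIV open_gap0)
  show "slab n \<inter> singles = {}" for n using gap0_sing[of n] by (auto simp: singles_eq)
  fix z assume "z \<notin> closure singles"
  then have "snd z \<notin> closure sing" by (cases z) (simp add: singles_eq closure_Times)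
  then obtain n m :: int where "snd z - of_int m \<in> gap0 n" by (rule not_closure_sing)
  then have "(fst z, snd z - of_int m) \<in> slab n" by simp
  moreover have "proj z = proj (fst z, snd z - of_int m)" by (simp add: proj_eq_iff)
  ultimately show "proj z \<in> (\<Union>n. proj ` slab n)" by (metis UN_iff UNIV_I image_eqI)
qed

lemma circ_gap0_homeomorphic: "{0<..<1::real} homeomorphic circ ` gap0 n"
proof -
  have "{0<..<1::real} homeomorphic (UNIV :: real set)" by (rule homeomorphic_open_interval_UNIV) simp
  also have "(UNIV :: real set) homeomorphic gap0 n"
    unfolding gap0_interval using wt_pos[of n]
    by (subst homeomorphic_sym, intro homeomorphic_open_interval_UNIV) simp
  also have "gap0 n homeomorphic circ ` gap0 n"
    unfolding gap0_interval using wt_le[of n] by (intro homeomorphic_circ_image) simp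
  finally (homeomorphic_trans) show ?thesis .
qed

text \<open>The parametrization leaves the circle factor untouched; essentiality follows since the
  other factor, an open arc, is simply connected.\<close>

lemma is_essential_annulus_slab: "is_essential_annulus (proj ` slab n)"
proof -
  obtain g k where gk: "homeomorphism {0<..<1::real} (circ ` gap0 n) g k"
    using circ_gap0_homeomorphic[of n] by (auto simp: homeomorphic_def)
  have "homeomorphism (sphere (0::complex) 1 \<times> {0<..<1::real}) (sphere 0 1 \<times> circ ` gap0 n)
      (\<lambda>z. (fst z, g (snd z))) (\<lambda>z. (fst z, k (snd z)))"
  proof (rule homeomorphismI)
    show "continuous_on (sphere (0::complex) 1 \<times> {0<..<1::real}) (\<lambda>z. (fst z, g (snd z)))"
      by (intro continuous_on_Pair continuous_on_fst continuous_on_id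
          continuous_on_compose2[OF homeomorphism_cont1[OF gk] continuous_on_snd[OF continuous_on_id]]) auto
    show "continuous_on (sphere 0 1 \<times> circ ` gap0 n) (\<lambda>z. (fst z, k (snd z)))"
      by (intro continuous_on_Pair continuous_on_fst continuous_on_id
          continuous_on_compose2[OF homeomorphism_cont2[OF gk] continuous_on_snd[OF continuous_on_id]]) auto
  qed (use homeomorphism_image1[OF gk] homeomorphism_image2[OF gk] homeomorphism_apply1[OF gk] homeomorphism_apply2[OF gk] in auto)
  then have "(sphere (0::complex) 1 \<times> {0<..<1::real}) homeomorphic proj ` slab n"
    unfolding proj_slab homeomorphic_def by blast
  moreover have "simply_connected (circ ` gap0 n)"
    by (rule homeomorphic_simply_connected[OF circ_gap0_homeomorphic]) (simp add: convex_imp_simply_connected)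
  then have "pi1_injective (proj ` slab n) T2"
    unfolding proj_slab T2_def by (rule pi1_injective_slab)
  moreover have "proj ` slab n \<subseteq> T2" by auto
  ultimately show ?thesis by (simp add: is_essential_annulus_def)
qed

lemma slab_components:
  shows "U \<in> components (T2 - Mset) \<Longrightarrow> is_essential_annulus U"
    and "proj ` slab 0 \<in> components (T2 - Mset)"
proof -
  have op: "openin (top_of_set T2) (proj ` slab n)" for n
    by (intro proj_open_map open_Times open_UNIV open_gap0)
  have con: "connected (proj ` slab n)" for n
    unfolding gap0_interval
    by (intro connected_continuous_image connected_Times continuous_on_proj continuous_on_id) auto
  have disj: "proj ` slab n \<inter> proj ` slab k = {}" if "n \<noteq> k" for n k
  proof -
    have "p \<notin> proj ` slab k" if p: "p \<in> proj ` slab n" for p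
    proof
      assume "p \<in> proj ` slab k"
      then obtain w where w: "w \<in> slab k" "p = proj w" by blast
      obtain z where z: "z \<in> slab n" "p = proj z" using p by blast
      have "snd z - snd w \<in> \<int>" using w z by (simp add: proj_eq_iff)
      then have "n = k" using w z gap0_disjoint[of "snd z" n "snd w" k] by auto
      then show False using \<open>n \<noteq> k\<close> by simp
    qed
    then show ?thesis by blast
  qed
  note comp = components_Union_disjoint_open[where U = "\<lambda>n. proj ` slab n", OF op con, folded complement]
  show "is_essential_annulus U" if "U \<in> components (T2 - Mset)"
  proof -
    have "\<exists>n. U = proj ` slab n" by (rule comp(1)[OF _ that]) (rule disj)
    then show ?thesis using is_essential_annulus_slab by auto
  qed
  show "proj ` slab 0 \<in> components (T2 - Mset)"
    by (rule comp(2), erule disj) (use gap0_nonempty in auto)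
qed

lemma singles_nonempty: "singles \<noteq> {}"
  using sing_nonempty by (simp add: singles_eq)

end

lemma rat_indep_irrational:
  assumes "rat_indep \<alpha> \<beta>"
  shows "of_int n * \<alpha> = of_int m \<Longrightarrow> n = 0" and "of_int n * \<beta> = of_int m \<Longrightarrow> n = 0"
proof -
  have *: "i = 0 \<and> j = 0 \<and> k = 0" if "of_int i + of_int j * \<alpha> + of_int k * \<beta> = 0" for i j k :: int
    using assms that unfolding rat_indep_def by blast
  show "n = 0" if "of_int n * \<alpha> = of_int m" using *[of "-m" n 0] that by simp
  show "n = 0" if "of_int n * \<beta> = of_int m" using *[of "-m" 0 n] that by simp
qed

lemma circle_blowup_irrational:
  assumes "\<And>n m :: int. of_int n * \<beta> = of_int m \<Longrightarrow> n = 0"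
  shows "circle_blowup \<beta>"
  by unfold_locales (use assms in auto)

theorem type_II:
  assumes "rat_indep \<alpha> \<beta>"
  shows "\<exists>f M. homeo_star f \<and> minimal_set f M \<and> M \<noteq> T2 \<and>
    (\<forall>U \<in> components (T2 - M). is_disk U \<or> is_essential_annulus U) \<and>
    (\<exists>U \<in> components (T2 - M). is_essential_annulus U)"
proof -
  interpret circle_blowup \<beta>
    by (rule circle_blowup_irrational) (rule rat_indep_irrational(2)[OF assms])
  interpret annulus_blowup \<beta> \<alpha>
    by unfold_locales (rule assms)
  have "Mset \<noteq> T2" using slab_components(2) in_components_nonempty by fastforce
  then show ?thesis
    using homeo_star_F minimal_set_Mset[OF singles_nonempty] slab_components is_essential_annulus_slab by blast
qed

subsection \<open>Type III\<close>

text \<open>Two missing points, one on each arc between \<open>u\<close> and \<open>v\<close>, cut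
  the circle into open arcs that separate \<open>u\<close> from \<open>v\<close>.\<close>

lemma circle_totally_disconnected:
  assumes K: "connected K" "K \<subseteq> sphere 0 1" "u \<in> K" "v \<in> K"
    and gaps: "\<And>c d. c < d \<Longrightarrow> \<exists>g. c < g \<and> g < d \<and> circ g \<notin> K"
  shows "u = v"
proof (rule ccontr)
  assume "u \<noteq> v"
  have "norm u = 1" "norm v = 1" using K by auto
  then obtain s where s: "u = circ s" using circ_surj[of u 0] by blast
  obtain t where t: "t \<in> {s..<s+1}" "v = circ t" using circ_surj[of v s] \<open>norm v = 1\<close> by blast
  have "s < t" "t < s + 1" using t s \<open>u \<noteq> v\<close> by (auto simp: less_le)
  obtain g where g: "s < g" "g < t" "circ g \<notin> K" using gaps[OF \<open>s < t\<close>] by blast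
  obtain g' where g': "t < g'" "g' < s + 1" "circ g' \<notin> K" using gaps[OF \<open>t < s + 1\<close>] by blast
  let ?A = "circ ` {g<..<g'}" and ?B = "circ ` {g'<..<g + 1}"
  have "K \<inter> ?A = {} \<or> K \<inter> ?B = {}"
  proof (rule connected_openin_cases[OF K(1) circ_open_map circ_open_map])
    show "K \<subseteq> ?A \<union> ?B"
    proof
      fix w assume w: "w \<in> K"
      then have "norm w = 1" using K(2) by auto
      then obtain r where r: "r \<in> {g..<g+1}" "w = circ r" by (rule circ_surj)
      have "r \<noteq> g" "r \<noteq> g'" using r w g(3) g'(3) by auto
      then show "w \<in> ?A \<union> ?B" using r by (cases "r < g'") auto
    qed
    have "circ r \<noteq> circ r'" if "r \<in> {g<..<g'}" "r' \<in> {g'<..<g + 1}" for r r'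
    proof
      assume "circ r = circ r'"
      then obtain m :: int where "r' - r = of_int m" by (metis circ_eq_iff Ints_cases)
      moreover have "0 < r' - r" "r' - r < 1" using that by auto
      ultimately show False by simp
    qed
    then show "?A \<inter> ?B = {}" by fastforce
  qed auto
  moreover have "v \<in> K \<inter> ?A" using K(4) t g g' by auto
  \<comment> \<open>The second arc passes through \<open>s + 1\<close> rather than \<open>s\<close>,
    so \<open>u\<close> is represented one turn later.\<close>
  moreover have "u = circ (s + 1)" using s circ_add_int[of 1 s] by simp
  then have "u \<in> K \<inter> ?B" using K(3) g g' by auto
  ultimately show False by blast
qed

text \<open>The complement is the union of two products of a punctured circle with a circle, which
  share the point half a turn away in both coordinates.\<close>

lemma connected_torus_minus_point:
  assumes "p \<in> T2"
  shows "connected (T2 - {p})"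
proof -
  obtain z where z: "p = proj z" using assms by (rule T2_cases)
  have S: "connected (sphere (0::complex) 1)"
    unfolding circ_image_Icc[of 0, symmetric]
    by (intro connected_continuous_image continuous_on_circ continuous_on_id connected_Icc)
  have S1: "sphere 0 1 - {circ s} = circ ` {s<..<s+1}" for s
  proof
    show "sphere 0 1 - {circ s} \<subseteq> circ ` {s<..<s+1}"
    proof
      fix u assume u: "u \<in> sphere 0 1 - {circ s}"
      then have "norm u = 1" by auto
      then obtain t where t: "t \<in> {s..<s+1}" "u = circ t" by (rule circ_surj)
      then have "t \<noteq> s" using u by auto
      then show "u \<in> circ ` {s<..<s+1}" using t by auto
    qed
    have "circ t \<noteq> circ s" if "t \<in> {s<..<s+1}" for t
    proof
      assume "circ t = circ s"
      then obtain m :: int where "t - s = of_int m" by (metis circ_eq_iff Ints_cases)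
      moreover have "0 < t - s" "t - s < 1" using that by auto
      ultimately show False by simp
    qed
    then show "circ ` {s<..<s+1} \<subseteq> sphere 0 1 - {circ s}" by auto
  qed
  have P: "connected (sphere 0 1 - {circ s})" for s
    unfolding S1 by (intro connected_continuous_image continuous_on_circ continuous_on_id) simp
  have ne: "circ (s + 1/2) \<in> sphere 0 1 - {circ s}" for s
    unfolding S1 by simp
  have "T2 - {p} = (sphere 0 1 - {circ (fst z)}) \<times> sphere 0 1 \<union> sphere 0 1 \<times> (sphere 0 1 - {circ (snd z)})"
    by (auto simp: z proj_eq T2_def)
  moreover have "connected \<dots>"
  proof (rule connected_Un)
    show "connected ((sphere 0 1 - {circ (fst z)}) \<times> sphere (0::complex) 1)"
      "connected (sphere (0::complex) 1 \<times> (sphere 0 1 - {circ (snd z)}))"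
      by (intro connected_Times P S)+
    have "(circ (fst z + 1/2), circ (snd z + 1/2)) \<in> (sphere 0 1 - {circ (fst z)}) \<times> sphere 0 1 \<inter> sphere 0 1 \<times> (sphere 0 1 - {circ (snd z)})"
      using ne[of "fst z"] ne[of "snd z"] by auto
    then show "(sphere 0 1 - {circ (fst z)}) \<times> sphere 0 1 \<inter> sphere 0 1 \<times> (sphere 0 1 - {circ (snd z)}) \<noteq> {}" by blast
  qed
  ultimately show ?thesis by simp
qed

text \<open>The preimage is a translate of the lattice, hence countable, while a connected set with
  two points is uncountable.\<close>

lemma bounded_T2_point:
  assumes "p \<in> T2"
  shows "bounded_T2 {p}"
proof -
  obtain z where z: "p = proj z" using assms by (rule T2_cases)
  define C where "C = connected_component_set (proj -` {p}) z"
  have zin: "z \<in> proj -` {p}" using z by simp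
  have "countable (proj -` {p})"
  proof (rule countable_subset)
    show "proj -` {p} \<subseteq> range (\<lambda>(i, j). z + (real_of_int i, real_of_int j))"
    proof
      fix w assume "w \<in> proj -` {p}"
      then obtain i j :: int where "w = z + (of_int i, of_int j)"
        using z proj_eq_iff_translate[of w z] by auto
      then show "w \<in> range (\<lambda>(i, j). z + (real_of_int i, real_of_int j))" by (intro image_eqI[of _ _ "(i, j)"]) auto
    qed
  qed simp
  then have cC: "countable C" unfolding C_def using connected_component_subset countable_subset by blast
  have "C \<subseteq> {z}"
  proof
    fix w assume w: "w \<in> C"
    have "z \<in> C" unfolding C_def using zin by simp
    then show "w \<in> {z}" using connected_uncountable[of C z w] w cC by (auto simp: C_def)
  qed
  then have "bounded C" using bounded_subset bounded_insert bounded_empty by metis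
  moreover have "C \<in> components (proj -` {p})" unfolding C_def using zin by (auto simp: components_def)
  ultimately show ?thesis unfolding bounded_T2_def by blast
qed

lemma acyclic_T2_point:
  assumes "p \<in> T2"
  shows "acyclic_T2 {p}"
  using assms bounded_T2_point connected_torus_minus_point by (simp add: acyclic_T2_def continuum_T2_def)

lemma is_fill_point:
  assumes "p \<in> T2"
  shows "is_fill {p} {p}"
  using acyclic_T2_point[OF assms] by (simp add: is_fill_def)

text \<open>The components are points, which are acyclic and thus their own fills; the identity
  serves as \<phi> and \<open>f\<close> itself as \<open>fh\<close>.\<close>

lemma extension_of_cantor_self:
  assumes f: "homeo_star f" and M: "minimal_set f M" "cantor_set M"
  shows "extension_of_cantor f M"
proof -
  have MT: "M \<subseteq> T2" using M(1) by (simp add: minimal_set_def)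
  have single: "\<exists>p\<in>T2. L = {p}" if L: "L \<in> components M" for L
  proof -
    obtain p where "p \<in> M" "L = connected_component_set M p" using L unfolding components_def by blast
    then show ?thesis using M(2) MT by (auto simp: cantor_set_def)
  qed
  have U: "id ` \<Union>((\<lambda>L. L) ` components M) = M" by (simp add: Union_components)
  show ?thesis
    unfolding extension_of_cantor_def
  proof (rule exI[of _ "\<lambda>L. L"], intro conjI ballI impI)
    show "is_fill L L" if "L \<in> components M" for L using single[OF that] is_fill_point by blast
    show "L1 \<inter> L2 = {}" if "L1 \<in> components M" "L2 \<in> components M" "L1 \<noteq> L2" for L1 L2
      using that components_nonoverlap by blast
    show "\<exists>\<phi> fh. continuous_on T2 \<phi> \<and> \<phi> ` T2 \<subseteq> T2 \<and>
           homotopic_with_canon (\<lambda>_. True) T2 T2 \<phi> id \<and> homeo_star fh \<and>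
           (\<forall>x \<in> T2. \<phi> (f x) = fh (\<phi> x)) \<and>
           minimal_set fh (\<phi> ` \<Union>((\<lambda>L. L) ` components M)) \<and>
           cantor_set (\<phi> ` \<Union>((\<lambda>L. L) ` components M))"
      by (rule exI[of _ id], rule exI[of _ f], unfold U, intro conjI f M) auto
  qed
qed

section \<open>The product of two Denjoy homeomorphisms\<close>

locale cantor_blowup = X: circle_blowup \<alpha> + Y: circle_blowup \<beta> for \<alpha> \<beta> +
  assumes indep: "rat_indep \<alpha> \<beta>"
begin

sublocale torus_semiconj X.D "\<lambda>_. Y.D" "\<lambda>z. (X.h (fst z), Y.h (snd z))" \<alpha> \<beta> 1
proof
  show "fibred X.D (\<lambda>_. Y.D)"
    unfolding fibred_def
    by (auto simp: X.D_plus1 Y.D_plus1 X.strict_mono_D Y.strict_mono_D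
        intro!: continuous_intros continuous_on_compose2[OF Y.continuous_on_D] X.continuous_on_D)
  show "continuous_on UNIV (\<lambda>z. (X.h (fst z), Y.h (snd z)))"
    by (auto intro!: continuous_intros continuous_on_compose2[OF X.continuous_on_h] continuous_on_compose2[OF Y.continuous_on_h])
  show "norm ((X.h (fst z), Y.h (snd z)) - z) \<le> 1" for z
  proof -
    have "norm ((X.h (fst z), Y.h (snd z)) - z) = norm (X.h (fst z) - fst z, Y.h (snd z) - snd z)" by (cases z) simp
    also have "\<dots> \<le> \<bar>X.h (fst z) - fst z\<bar> + \<bar>Y.h (snd z) - snd z\<bar>"
      unfolding norm_Pair using sqrt_sum_squares_le_sum_abs by simp
    finally show ?thesis using X.h_near_id[of "fst z"] Y.h_near_id[of "snd z"] by linarith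
  qed
qed (auto simp: equivariant_def X.h_plus1 Y.h_plus1 fibmap_def X.h_D Y.h_D indep)

lemma singles_eq: "singles = X.sing \<times> Y.sing"
proof (intro set_eqI iffI)
  fix z assume z: "z \<in> singles"
  have "t' = fst z" if "X.h t' = X.h (fst z)" for t'
    using singlesD[OF z, of "(t', snd z)"] that by (metis fst_conv snd_conv)
  moreover have "t' = snd z" if "Y.h t' = Y.h (snd z)" for t'
    using singlesD[OF z, of "(fst z, t')"] that by (metis fst_conv snd_conv)
  ultimately show "z \<in> X.sing \<times> Y.sing" by (simp add: X.mem_sing Y.mem_sing mem_Times_iff)
next
  fix z assume "z \<in> X.sing \<times> Y.sing"
  then show "z \<in> singles" by (intro singlesI) (auto simp: X.mem_sing Y.mem_sing prod_eq_iff)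
qed

lemma gaps_not_Mset:
  shows "t - of_int m \<in> X.gap0 n \<Longrightarrow> (circ t, w) \<notin> Mset"
    and "t - of_int m \<in> Y.gap0 n \<Longrightarrow> (w, circ t) \<notin> Mset"
proof -
  \<comment> \<open>Here \<open>w\<close> is arbitrary; \<open>q\<close> may be assumed to lie on
    the torus because \<open>Mset\<close> does.\<close>
  have aux: "q \<notin> Mset" if "open W" "W \<inter> singles = {}" "q \<in> T2 \<Longrightarrow> q \<in> proj ` W" for q W
    using open_disjoint_Mset[OF that(1,2)] that(3) Mset_subset by blast
  show "(circ t, w) \<notin> Mset" if t: "t - of_int m \<in> X.gap0 n"
  proof (rule aux)
    show "open (X.gap0 n \<times> UNIV)" by (intro open_Times open_UNIV X.open_gap0)
    show "X.gap0 n \<times> UNIV \<inter> singles = {}" using X.gap0_sing[of n] by (auto simp: singles_eq)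
    assume "(circ t, w) \<in> T2"
    then have "norm w = 1" by (simp add: T2_def)
    then obtain s where "w = circ s" using circ_surj[of w 0] by blast
    then have "(circ t, w) = proj (t - of_int m, s)" by (simp add: proj_eq circ_eq_iff)
    then show "(circ t, w) \<in> proj ` (X.gap0 n \<times> UNIV)" using t by (intro image_eqI) auto
  qed
  show "(w, circ t) \<notin> Mset" if t: "t - of_int m \<in> Y.gap0 n"
  proof (rule aux)
    show "open (UNIV \<times> Y.gap0 n)" by (intro open_Times open_UNIV Y.open_gap0)
    show "UNIV \<times> Y.gap0 n \<inter> singles = {}" using Y.gap0_sing[of n] by (auto simp: singles_eq)
    assume "(w, circ t) \<in> T2"
    then have "norm w = 1" by (simp add: T2_def)
    then obtain s where "w = circ s" using circ_surj[of w 0] by blast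
    then have "(w, circ t) = proj (s, t - of_int m)" by (simp add: proj_eq circ_eq_iff)
    then show "(w, circ t) \<in> proj ` (UNIV \<times> Y.gap0 n)" using t by (intro image_eqI) auto
  qed
qed

text \<open>Each coordinate of \<open>C\<close> traces a connected subset of the circle that misses
  every gap; as the gaps are dense, it is a point.\<close>

lemma Mset_totally_disconnected:
  assumes "connected C" "C \<subseteq> Mset" "p \<in> C" "q \<in> C"
  shows "p = q"
proof -
  have CT: "C \<subseteq> T2" using assms(2) Mset_subset by blast
  have "fst p = fst q"
  proof (rule circle_totally_disconnected[of "fst ` C"])
    show "connected (fst ` C)" by (intro connected_continuous_image continuous_on_fst continuous_on_id assms)
    show "fst ` C \<subseteq> sphere 0 1" using CT by (auto simp: T2_def)
    fix c d :: real assume "c < d"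
    then obtain t n m where t: "c < t" "t < d" "t - of_int m \<in> X.gap0 n" by (rule X.gap0_dense)
    have "circ t \<notin> fst ` C"
    proof
      assume "circ t \<in> fst ` C"
      then obtain r where "r \<in> C" "circ t = fst r" by blast
      then have "(circ t, snd r) \<in> Mset" using assms(2) by (cases r) auto
      then show False using gaps_not_Mset(1)[OF t(3)] by blast
    qed
    then show "\<exists>g. c < g \<and> g < d \<and> circ g \<notin> fst ` C" using t by blast
  qed (use assms in auto)
  moreover have "snd p = snd q"
  proof (rule circle_totally_disconnected[of "snd ` C"])
    show "connected (snd ` C)" by (intro connected_continuous_image continuous_on_snd continuous_on_id assms)
    show "snd ` C \<subseteq> sphere 0 1" using CT by (auto simp: T2_def)
    fix c d :: real assume "c < d"
    then obtain t n m where t: "c < t" "t < d" "t - of_int m \<in> Y.gap0 n" by (rule Y.gap0_dense)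
    have "circ t \<notin> snd ` C"
    proof
      assume "circ t \<in> snd ` C"
      then obtain r where "r \<in> C" "circ t = snd r" by blast
      then have "(fst r, circ t) \<in> Mset" using assms(2) by (cases r) auto
      then show False using gaps_not_Mset(2)[OF t(3)] by blast
    qed
    then show "\<exists>g. c < g \<and> g < d \<and> circ g \<notin> snd ` C" using t by blast
  qed (use assms in auto)
  ultimately show ?thesis by (simp add: prod_eq_iff)
qed

lemma singles_islimpt:
  assumes "z \<in> singles"
  shows "proj z islimpt proj ` singles"
  unfolding islimpt_approachable
proof (intro allI impI)
  fix \<epsilon> :: real assume "\<epsilon> > 0"
  have "isCont proj z" using continuous_on_proj[OF continuous_on_id, of UNIV]
    by (metis UNIV_I continuous_on_eq_continuous_at open_UNIV)
  then obtain d where d: "d > 0" "\<And>w. dist w z < d \<Longrightarrow> dist (proj w) (proj z) < \<epsilon>"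
    using \<open>\<epsilon> > 0\<close> unfolding continuous_at_eps_delta by blast
  have z: "fst z \<in> X.sing" "snd z \<in> Y.sing" using assms by (auto simp: singles_eq)
  \<comment> \<open>Moving the second coordinate alone suffices. A distance below 1 rules out an
    integer translate, so the projections stay distinct.\<close>
  have "min d 1 > 0" using d by simp
  then obtain t where t: "t \<in> Y.sing" "t \<noteq> snd z" "dist t (snd z) < min d 1"
    using Y.sing_islimpt[OF z(2)] unfolding islimpt_approachable by blast
  define w where "w = (fst z, t)"
  have "w \<in> singles" using z t by (simp add: w_def singles_eq)
  moreover have "dist w z < d" using t by (cases z) (simp add: w_def dist_Pair_Pair)
  moreover have "proj w \<noteq> proj z"
  proof
    assume "proj w = proj z"
    then obtain m :: int where m: "t - snd z = of_int m" by (auto simp: w_def proj_eq_iff elim: Ints_cases)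
    have "\<bar>t - snd z\<bar> < 1" using t(3) by (simp add: dist_real_def)
    then have "m = 0" unfolding m by linarith
    then show False using m t by simp
  qed
  ultimately show "\<exists>q\<in>proj ` singles. q \<noteq> proj z \<and> dist q (proj z) < \<epsilon>" using d(2) by blast
qed

lemma cantor_set_Mset: "cantor_set Mset"
  unfolding cantor_set_def
proof (intro conjI ballI)
  show "Mset \<noteq> {}" using proj_singles_subset X.sing_nonempty Y.sing_nonempty singles_eq by blast
  show "compact Mset" by (rule Mset_compact)
  show "p islimpt Mset" if "p \<in> Mset" for p
  proof -
    have "p islimpt proj ` singles"
      using that singles_islimpt unfolding Mset_def closure_def by blast
    then show ?thesis using proj_singles_subset islimpt_subset by blast
  qed
  show "connected_component_set Mset p = {p}" if "p \<in> Mset" for p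
  proof -
    have "p \<in> connected_component_set Mset p" using that by simp
    moreover have "q = p" if "q \<in> connected_component_set Mset p" for q
      by (rule Mset_totally_disconnected[OF connected_connected_component connected_component_subset that])
        (use \<open>p \<in> Mset\<close> in simp)
    ultimately show ?thesis by blast
  qed
qed

lemma singles_nonempty: "singles \<noteq> {}"
  using X.sing_nonempty Y.sing_nonempty by (simp add: singles_eq)

lemma Mset_not_T2: "Mset \<noteq> T2"
proof -
  obtain t n and m :: int where "t - of_int m \<in> X.gap0 n" using X.gap0_dense[of 0 1] by (metis zero_less_one)
  then have "(circ t, circ 0) \<notin> Mset" by (rule gaps_not_Mset)
  moreover have "(circ t, circ 0) \<in> T2" by (simp add: T2_def)
  ultimately show ?thesis by blast
qed

end

theorem type_III:
  assumes "rat_indep \<alpha> \<beta>"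
  shows "\<exists>f M. homeo_star f \<and> minimal_set f M \<and> M \<noteq> T2 \<and> extension_of_cantor f M"
proof -
  interpret X: circle_blowup \<alpha>
    by (rule circle_blowup_irrational) (rule rat_indep_irrational(1)[OF assms])
  interpret Y: circle_blowup \<beta>
    by (rule circle_blowup_irrational) (rule rat_indep_irrational(2)[OF assms])
  interpret cantor_blowup \<alpha> \<beta>
    by unfold_locales (rule assms)
  have min: "minimal_set (descend F) Mset" by (rule minimal_set_Mset[OF singles_nonempty])
  show ?thesis
    using homeo_star_F min Mset_not_T2 extension_of_cantor_self[OF homeo_star_F min cantor_set_Mset] by blast
qed

theorem theoremB:
  shows "\<exists>f1 f2 f3 M1 M2 M3.
    homeo_star f1 \<and> homeo_star f2 \<and> homeo_star f3 \<and>
    minimal_set f1 M1 \<and> minimal_set f2 M2 \<and> minimal_set f3 M3 \<and>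
    M1 \<noteq> T2 \<and> M2 \<noteq> T2 \<and> M3 \<noteq> T2 \<and>
    (\<forall>U \<in> components (T2 - M1). is_disk U) \<and>
    (\<forall>U \<in> components (T2 - M2). is_disk U \<or> is_essential_annulus U) \<and>
    (\<exists>U \<in> components (T2 - M2). is_essential_annulus U) \<and>
    extension_of_cantor f3 M3"
proof -
  obtain \<alpha> \<beta> where indep: "rat_indep \<alpha> \<beta>" using rat_indep_exists by blast
  obtain f1 M1 where 1: "homeo_star f1" "minimal_set f1 M1" "M1 \<noteq> T2"
    "\<forall>U \<in> components (T2 - M1). is_disk U"
    using type_I[OF indep] by blast
  obtain f2 M2 where 2: "homeo_star f2" "minimal_set f2 M2" "M2 \<noteq> T2"
    "\<forall>U \<in> components (T2 - M2). is_disk U \<or> is_essential_annulus U"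
    "\<exists>U \<in> components (T2 - M2). is_essential_annulus U"
    using type_II[OF indep] by blast
  obtain f3 M3 where 3: "homeo_star f3" "minimal_set f3 M3" "M3 \<noteq> T2" "extension_of_cantor f3 M3"
    using type_III[OF indep] by blast
  show ?thesis
    by (intro exI[of _ f1] exI[of _ f2] exI[of _ f3] exI[of _ M1] exI[of _ M2] exI[of _ M3] conjI) (fact 1 2 3)+
qed

end
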